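(* Let $(W,S)$ be a finite Coxeter system, $Q=q_1\cdots q_m$ a word on $S$, and $\rho\in W$ such that the subword complex $\mathcal{SC}(Q,\rho)$ is double root free. Let $I$ and $J$ be two facets of $\mathcal{SC}(Q,\rho)$ such that there is a directed path from $I$ to $J$ in the increasing flip graph $\mathcal G(Q,\rho)$. Then the unique $\mathsf p$-rising (resp. $\mathsf n$-rising) path from $I$ to $J$ has maximal length among all paths from $I$ to $J$. Moreover, if there is a $\mathsf p$-falling (resp. $\mathsf n$-falling) path from $I$ to $J$, it has minimal length among all paths from $I$ to $J$.
   Context: Let $(W,S)$ be a finite Coxeter system acting by reflections on a Euclidean space $V$, with length function $\ell$, root system $\Phi$ and simple roots $\{\alpha_s: s\in S\}$. Let $Q=q_1q_2\cdots q_m$ be a word in the letters $S$ and $\rho\in W$; write $[m]=\{1,\dots,m\}$. The subword complex $\mathcal{SC}(Q,\rho)$ is the simplicial complex whose facets are the sets $I\subseteq[m]$ such that the letters of $Q$ at the positions in $[m]\setminus I$, read in increasing order of position, form a reduced expression of $\rho$. The root function of a facet $I$ is $\mathsf r(I,k)=w(\alpha_{q_k})\in\Phi$ for $k\in[m]$, where $w$ is the product of the $q_x$, $x\in[k-1]\setminus I$, in increasing order of position. Two distinct facets $I,J$ are adjacent if $I\setminus\{i\}=J\setminus\{j\}$ for some $i\in I$, $j\in J$; then $i$ is called flippable in $I$. The flip from $I$ to $J$ is increasing if $i<j$. The increasing flip graph $\mathcal G(Q,\rho)$ is the directed graph whose vertices are the facets and whose edges $I\to J$ are the increasing flips. For an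 edge $I\to J$ with $I\setminus\{i\}=J\setminus\{j\}$, $i<j$, set $\mathsf p(I\to J)=i$ and $\mathsf n(I\to J)=j$. For $\lambda\in\{\mathsf p,\mathsf n\}$, a path is $\lambda$-rising (resp. $\lambda$-falling) if the sequence of $\lambda$-labels of its successive edges is strictly increasing (resp. weakly decreasing); its length is its number of edges. Whenever there is a directed path from $I$ to $J$, there is exactly one $\lambda$-rising path from $I$ to $J$. The subword complex has a double root if there is a facet $I$ and two distinct positions $i\neq j$, both flippable in $I$, with $\mathsf r(I,i)=\mathsf r(I,j)$; otherwise it is double root free. *)

theory Defs
  imports "HOL-Analysis.Analysis" "HOL-Algebra.Algebra" "Graph_Theory.Graph_Theory"
begin

section \<open>Coxeter systems\<close>

definition word_prod :: "('w, 'b) monoid_scheme \<Rightarrow> 'w list \<Rightarrow> 'w" where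
  "word_prod W ws = foldr (\<otimes>\<^bsub>W\<^esub>) ws \<one>\<^bsub>W\<^esub>"

text \<open>
  The congruence on words over \<open>S\<close> generated by the Coxeter relations \<open>(st)\<^sup>m = e\<close>, where
  \<open>m\<close> is the order of \<open>st\<close> in \<open>W\<close>. For \<open>s = t\<close> the order is 1 and the relation is
  \<open>ss = e\<close>, so no formal inverses are needed; \<open>group.ord\<close> is 0 for infinite order, and then
  the relation is void.
\<close>

inductive coxeter_equiv :: "('w, 'b) monoid_scheme \<Rightarrow> 'w set \<Rightarrow> 'w list \<Rightarrow> 'w list \<Rightarrow> bool"
  for W S where
  relation: "\<lbrakk>u \<in> lists S; v \<in> lists S; s \<in> S; t \<in> S\<rbrakk> \<Longrightarrow>
    coxeter_equiv W S (u @ concat (replicate (group.ord W (s \<otimes>\<^bsub>W\<^esub> t)) [s, t]) @ v) (u @ v)"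
| refl: "u \<in> lists S \<Longrightarrow> coxeter_equiv W S u u"
| sym: "coxeter_equiv W S u v \<Longrightarrow> coxeter_equiv W S v u"
| trans: "\<lbrakk>coxeter_equiv W S u v; coxeter_equiv W S v w\<rbrakk> \<Longrightarrow> coxeter_equiv W S u w"

text \<open>
  \<open>W\<close> is presented by the involutive generators \<open>S\<close> and the Coxeter relations.
\<close>

definition coxeter_system :: "('w, 'b) monoid_scheme \<Rightarrow> 'w set \<Rightarrow> bool" where
  "coxeter_system W S \<longleftrightarrow>
     group W \<and> S \<subseteq> carrier W \<and> (\<forall>s\<in>S. group.ord W s = 2) \<and> generate W S = carrier W \<and>
     (\<forall>u\<in>lists S. \<forall>v\<in>lists S. word_prod W u = word_prod W v \<longrightarrow> coxeter_equiv W S u v)"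

definition coxeter_length :: "('w, 'b) monoid_scheme \<Rightarrow> 'w set \<Rightarrow> 'w \<Rightarrow> nat" where
  "coxeter_length W S w = (LEAST n. \<exists>ws\<in>lists S. length ws = n \<and> word_prod W ws = w)"

definition reduced_expression ::
  "('w, 'b) monoid_scheme \<Rightarrow> 'w set \<Rightarrow> 'w list \<Rightarrow> 'w \<Rightarrow> bool" where
  "reduced_expression W S ws w \<longleftrightarrow>
     ws \<in> lists S \<and> word_prod W ws = w \<and> length ws = coxeter_length W S w"


section \<open>Roots and the reflection action\<close>

definition reflection :: "'v::real_inner \<Rightarrow> 'v \<Rightarrow> 'v" where
  "reflection a x = x - (2 * (x \<bullet> a) / (a \<bullet> a)) *\<^sub>R a"

definition root_system :: "'v::euclidean_space set \<Rightarrow> bool" where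
  "root_system \<Phi> \<longleftrightarrow>
     finite \<Phi> \<and> 0 \<notin> \<Phi> \<and>
     (\<forall>a\<in>\<Phi>. \<Phi> \<inter> span {a} = {a, - a}) \<and>
     (\<forall>a\<in>\<Phi>. reflection a ` \<Phi> = \<Phi>)"

definition simple_system :: "'v::euclidean_space set \<Rightarrow> 'v set \<Rightarrow> bool" where
  "simple_system \<Phi> \<Delta> \<longleftrightarrow>
     \<Delta> \<subseteq> \<Phi> \<and> independent \<Delta> \<and>
     (\<forall>b\<in>\<Phi>. \<exists>c. b = (\<Sum>d\<in>\<Delta>. c d *\<^sub>R d) \<and> ((\<forall>d\<in>\<Delta>. 0 \<le> c d) \<or> (\<forall>d\<in>\<Delta>. c d \<le> 0)))"

text \<open>
  A finite Coxeter system \<open>(W, S)\<close> acting faithfully as a reflection group on the Euclidean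
  space \<open>'v\<close>; \<open>act w\<close> is the transformation given by \<open>w\<close>, \<open>\<Phi>\<close> is the root system, and
  \<open>\<alpha> s\<close> is the simple root of \<open>s\<close>. The simple roots need not span \<open>'v\<close>, so the action may
  fix a nonzero subspace (in particular \<open>W\<close> may be trivial).
\<close>

locale finite_coxeter_system =
  fixes W :: "('w, 'b) monoid_scheme" (structure)
    and S :: "'w set"
    and act :: "'w \<Rightarrow> 'v::euclidean_space \<Rightarrow> 'v"
    and \<Phi> :: "'v set"
    and \<alpha> :: "'w \<Rightarrow> 'v"
  assumes coxeter: "coxeter_system W S"
    and finite_carrier: "finite (carrier W)"
    and act_orthogonal: "w \<in> carrier W \<Longrightarrow> orthogonal_transformation (act w)"
    and act_one: "act \<one> = id"
    and act_mult: "\<lbrakk>v \<in> carrier W; w \<in> carrier W\<rbrakk> \<Longrightarrow> act (v \<otimes> w) = act v \<circ> act w"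
    and act_faithful: "inj_on act (carrier W)"
    and roots: "root_system \<Phi>"
    and simple_roots: "simple_system \<Phi> (\<alpha> ` S)"
    and act_simple: "s \<in> S \<Longrightarrow> act s = reflection (\<alpha> s)"


section \<open>Subword complexes\<close>

text \<open>
  Positions in a word \<open>Q\<close> are numbered \<open>0, \<dots>, length Q - 1\<close>, as in \<open>(!)\<close> and \<open>nths\<close>, instead
  of \<open>1, \<dots>, m\<close>.
\<close>

definition subword_facet ::
  "('w, 'b) monoid_scheme \<Rightarrow> 'w set \<Rightarrow> 'w list \<Rightarrow> 'w \<Rightarrow> nat set \<Rightarrow> bool" where
  "subword_facet W S Q \<rho> I \<longleftrightarrow>
     I \<subseteq> {..<length Q} \<and> reduced_expression W S (nths Q ({..<length Q} - I)) \<rho>"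

definition root_function ::
  "('w, 'b) monoid_scheme \<Rightarrow> ('w \<Rightarrow> 'v \<Rightarrow> 'v) \<Rightarrow> ('w \<Rightarrow> 'v) \<Rightarrow> 'w list \<Rightarrow> nat set \<Rightarrow> nat \<Rightarrow> 'v" where
  "root_function W act \<alpha> Q I k = act (word_prod W (nths Q ({..<k} - I))) (\<alpha> (Q ! k))"

definition exchange :: "nat set \<Rightarrow> nat \<Rightarrow> nat \<Rightarrow> nat set \<Rightarrow> bool" where
  "exchange I i j J \<longleftrightarrow> I \<noteq> J \<and> i \<in> I \<and> j \<in> J \<and> I - {i} = J - {j}"

definition flippable ::
  "('w, 'b) monoid_scheme \<Rightarrow> 'w set \<Rightarrow> 'w list \<Rightarrow> 'w \<Rightarrow> nat set \<Rightarrow> nat \<Rightarrow> bool" where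
  "flippable W S Q \<rho> I i \<longleftrightarrow> (\<exists>j J. subword_facet W S Q \<rho> J \<and> exchange I i j J)"

definition double_root_free ::
  "('w, 'b) monoid_scheme \<Rightarrow> 'w set \<Rightarrow> ('w \<Rightarrow> 'v \<Rightarrow> 'v) \<Rightarrow> ('w \<Rightarrow> 'v) \<Rightarrow> 'w list \<Rightarrow> 'w \<Rightarrow> bool" where
  "double_root_free W S act \<alpha> Q \<rho> \<longleftrightarrow>
     \<not> (\<exists>I i j. subword_facet W S Q \<rho> I \<and> i \<noteq> j \<and>
          flippable W S Q \<rho> I i \<and> flippable W S Q \<rho> I j \<and>
          root_function W act \<alpha> Q I i = root_function W act \<alpha> Q I j)"


section \<open>The increasing flip graph\<close>

definition increasing_flip_graph ::
  "('w, 'b) monoid_scheme \<Rightarrow> 'w set \<Rightarrow> 'w list \<Rightarrow> 'w \<Rightarrow> nat set pair_pre_digraph" where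
  "increasing_flip_graph W S Q \<rho> =
     \<lparr>pverts = {I. subword_facet W S Q \<rho> I},
      parcs = {(I, J). subword_facet W S Q \<rho> I \<and> subword_facet W S Q \<rho> J \<and>
                       (\<exists>i j. exchange I i j J \<and> i < j)}\<rparr>"

text \<open>
  A path is the list of its edges. Every edge increases the sum of the positions in the facet,
  so the graph is acyclic and directed walks (\<open>awalk\<close>) never repeat a vertex.
\<close>

definition flip_path ::
  "('w, 'b) monoid_scheme \<Rightarrow> 'w set \<Rightarrow> 'w list \<Rightarrow> 'w \<Rightarrow>
     nat set \<Rightarrow> (nat set \<times> nat set) list \<Rightarrow> nat set \<Rightarrow> bool" where
  "flip_path W S Q \<rho> I P J \<longleftrightarrow>
     pre_digraph.awalk (with_proj (increasing_flip_graph W S Q \<rho>)) I P J"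

definition p_label :: "nat set \<times> nat set \<Rightarrow> nat" where
  "p_label e = (THE i. \<exists>j. exchange (fst e) i j (snd e) \<and> i < j)"

definition n_label :: "nat set \<times> nat set \<Rightarrow> nat" where
  "n_label e = (THE j. \<exists>i. exchange (fst e) i j (snd e) \<and> i < j)"

definition rising :: "('e \<Rightarrow> nat) \<Rightarrow> 'e list \<Rightarrow> bool" where
  "rising l P \<longleftrightarrow> sorted_wrt (<) (map l P)"

definition falling :: "('e \<Rightarrow> nat) \<Rightarrow> 'e list \<Rightarrow> bool" where
  "falling l P \<longleftrightarrow> sorted_wrt (\<ge>) (map l P)"

end

theory Submission
  imports Defs
begin

text \<open>
  Consider a descent of the \<open>p\<close>-labels along a path: a flip of \<open>a\<close> followed by a flip of some
  \<open>i < a\<close>. The facets containing what these flips fix form a polygon, and the two flips can be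
  replaced by a flip of \<open>i\<close> followed by at least one more flip: either the flips commute, or the
  end of the descent is the sink of the polygon, and a facet that is a sink is determined by what
  it must contain. Moving the smallest label to the front in this way turns any path into the
  rising one without shortening it; the rising path is unique since its first label is the least
  position where \<open>I\<close> and \<open>J\<close> differ. On a falling path, a position that is flipped out never comes
  back, because it would yield a double root; so the length of such a path is the cardinality of
  \<open>I - J\<close>, a lower bound for all paths. Reversing the word exchanges the two labelings.
\<close>

section \<open>Reflections and roots\<close>

lemma reflection_uminus: "reflection (- a) = reflection a"
  by (auto simp: reflection_def fun_eq_iff)

lemma reflection_self: "a \<noteq> 0 \<Longrightarrow> reflection a a = - a"
  by (simp add: reflection_def scaleR_2)

lemma reflection_reflection:
  assumes "a \<noteq> 0"
  shows "reflection a (reflection a x) = x"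
  using assms by (simp add: reflection_def inner_diff_left divide_simps algebra_simps)

lemma reflection_comp_reflection: "a \<noteq> 0 \<Longrightarrow> reflection a \<circ> reflection a = id"
  by (simp add: fun_eq_iff reflection_reflection)

lemma linear_reflection: "linear (reflection a)"
  by (rule linearI) (auto simp: reflection_def inner_add_left algebra_simps add_divide_distrib)

text \<open>At \<open>b\<close> both reflections give \<open>- b\<close>, so twice \<open>b\<close>
  is a multiple of \<open>a\<close>.\<close>

lemma reflection_inject:
  fixes a b :: "'v::real_inner"
  assumes "reflection a = reflection b" "a \<noteq> 0"
  shows "b \<in> span {a}"
proof -
  have "reflection a b = - b \<or> b = 0"
    using assms(1) reflection_self[of b] by auto
  then have "2 *\<^sub>R b = (2 * (b \<bullet> a) / (a \<bullet> a)) *\<^sub>R a \<or> b = 0"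
    by (auto simp: reflection_def scaleR_2 algebra_simps)
  moreover have "b = (1 / 2) *\<^sub>R (2 *\<^sub>R b)" by simp
  ultimately have "b = (1 / 2) *\<^sub>R ((2 * (b \<bullet> a) / (a \<bullet> a)) *\<^sub>R a) \<or> b = 0" by metis
  then show ?thesis
    by (metis span_base span_scale span_zero insertI1)
qed

text \<open>This conjugation rule later turns a letter multiplied on the right into the reflection
  in a root multiplied on the left.\<close>

lemma orthogonal_transformation_reflection:
  assumes "orthogonal_transformation f"
  shows "f \<circ> reflection a = reflection (f a) \<circ> f"
  using assms
  by (auto simp: fun_eq_iff reflection_def orthogonal_transformation_def linear_diff linear_scale)

context finite_coxeter_system
begin

abbreviation \<Delta> :: "'v set" where "\<Delta> \<equiv> \<alpha> ` S"

lemma is_group: "group W"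
  using coxeter by (simp add: coxeter_system_def)

lemma S_carrier: "s \<in> S \<Longrightarrow> s \<in> carrier W"
  using coxeter by (auto simp: coxeter_system_def)

lemma S_square: "s \<in> S \<Longrightarrow> s \<otimes> s = \<one>"
proof -
  assume s: "s \<in> S"
  then have "group.ord W s = 2" using coxeter by (auto simp: coxeter_system_def)
  then have "s [^] (2::nat) = \<one>"
    using group.pow_ord_eq_1[OF is_group S_carrier[OF s]] by simp
  then show ?thesis
    using S_carrier[OF s] is_group
    by (simp add: numeral_2_eq_2 group.is_monoid monoid.nat_pow_0 monoid.nat_pow_Suc monoid.l_one)
qed

lemma alpha_root: "s \<in> S \<Longrightarrow> \<alpha> s \<in> \<Phi>"
  using simple_roots by (auto simp: simple_system_def)

lemma finite_\<Delta>: "finite \<Delta>"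
  using simple_roots roots by (auto simp: simple_system_def root_system_def intro: finite_subset)

lemma root_nonzero: "b \<in> \<Phi> \<Longrightarrow> b \<noteq> 0"
  using roots by (auto simp: root_system_def)

lemma root_line: "b \<in> \<Phi> \<Longrightarrow> \<Phi> \<inter> span {b} = {b, - b}"
  using roots by (simp add: root_system_def)

lemma root_uminus: "b \<in> \<Phi> \<Longrightarrow> - b \<in> \<Phi>"
  using root_line[of b] by auto

lemma root_reflection: "a \<in> \<Phi> \<Longrightarrow> b \<in> \<Phi> \<Longrightarrow> reflection a b \<in> \<Phi>"
  using roots by (auto simp: root_system_def)

lemma reflection_eq_imp:
  assumes "a \<in> \<Phi>" "b \<in> \<Phi>" "reflection a = reflection b"
  shows "b = a \<or> b = - a"
  using reflection_inject[OF assms(3)] root_nonzero[OF assms(1)] root_line[OF assms(1)] assms(2)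
  by blast

section \<open>Positive roots and simple reflections\<close>

definition pos :: "'v \<Rightarrow> bool" where
  "pos b \<longleftrightarrow> b \<in> \<Phi> \<and> (\<exists>c. (\<forall>d\<in>\<Delta>. 0 \<le> c d) \<and> b = (\<Sum>d\<in>\<Delta>. c d *\<^sub>R d))"

lemma coeff_unique:
  assumes "(\<Sum>d\<in>\<Delta>. c d *\<^sub>R d) = (\<Sum>d\<in>\<Delta>. c' d *\<^sub>R d)" "d \<in> \<Delta>"
  shows "c d = c' d"
proof -
  have "(\<Sum>d\<in>\<Delta>. (c d - c' d) *\<^sub>R d) = 0"
    using assms(1) by (simp add: scaleR_diff_left sum_subtractf)
  moreover have "independent \<Delta>" using simple_roots by (simp add: simple_system_def)
  ultimately have "c d - c' d = 0"
    using independentD[of \<Delta> \<Delta> "\<lambda>d. c d - c' d" d] finite_\<Delta> assms(2) by auto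
  then show ?thesis by simp
qed

lemma pos_root: "pos b \<Longrightarrow> b \<in> \<Phi>"
  by (simp add: pos_def)

lemma pos_cases: "b \<in> \<Phi> \<Longrightarrow> pos b \<or> pos (- b)"
proof -
  assume b: "b \<in> \<Phi>"
  then obtain c where c: "b = (\<Sum>d\<in>\<Delta>. c d *\<^sub>R d)"
    and sg: "(\<forall>d\<in>\<Delta>. 0 \<le> c d) \<or> (\<forall>d\<in>\<Delta>. c d \<le> 0)"
    using simple_roots unfolding simple_system_def by blast
  have "- b = (\<Sum>d\<in>\<Delta>. (- c d) *\<^sub>R d)" using c by (simp add: sum_negf)
  then show ?thesis
    using sg c b root_uminus[OF b] unfolding pos_def
    by (metis neg_0_le_iff_le)
qed

lemma not_pos_both: "pos b \<Longrightarrow> \<not> pos (- b)"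
proof
  assume "pos b" "pos (- b)"
  then obtain c c' where c: "\<forall>d\<in>\<Delta>. 0 \<le> c d" "b = (\<Sum>d\<in>\<Delta>. c d *\<^sub>R d)"
    and c': "\<forall>d\<in>\<Delta>. 0 \<le> c' d" "- b = (\<Sum>d\<in>\<Delta>. c' d *\<^sub>R d)"
    unfolding pos_def by blast
  have eq: "b = (\<Sum>d\<in>\<Delta>. (- c' d) *\<^sub>R d)" using c'(2) by (metis (no_types, lifting) minus_minus scaleR_minus_left sum.cong sum_negf)
  have "c d = 0" if "d \<in> \<Delta>" for d
    using coeff_unique[of c "\<lambda>d. - c' d" d] that c c' eq by force
  then have "b = 0" using c(2) by simp
  then show False using root_nonzero \<open>pos b\<close> pos_root by blast
qed

lemma not_pos_iff: "b \<in> \<Phi> \<Longrightarrow> \<not> pos b \<longleftrightarrow> pos (- b)"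
  using pos_cases not_pos_both by blast

lemma pos_alpha: "s \<in> S \<Longrightarrow> pos (\<alpha> s)"
proof -
  assume s: "s \<in> S"
  have "(\<Sum>d\<in>\<Delta>. (if d = \<alpha> s then 1 else 0) *\<^sub>R d) = (\<Sum>d\<in>\<Delta>. if d = \<alpha> s then d else 0)"
    by (rule sum.cong) auto
  then have "\<alpha> s = (\<Sum>d\<in>\<Delta>. (if d = \<alpha> s then 1 else 0) *\<^sub>R d)"
    using finite_\<Delta> s by (auto simp: sum.delta')
  then show ?thesis
    unfolding pos_def using alpha_root[OF s]
    by (intro conjI exI[of _ "\<lambda>d. if d = \<alpha> s then 1 else 0"]) auto
qed

text \<open>The reflection changes only the coefficient of \<open>\<alpha> s\<close>. If the image
  were negative, all other coefficients of \<open>b\<close> would vanish, and \<open>b\<close> would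
  be a root on the line of \<open>\<alpha> s\<close>, hence \<open>- \<alpha> s\<close>, which is
  not positive.\<close>

lemma pos_reflection_simple:
  assumes s: "s \<in> S" and b: "pos b" "b \<noteq> \<alpha> s"
  shows "pos (reflection (\<alpha> s) b)"
proof (rule ccontr)
  let ?b = "reflection (\<alpha> s) b"
  have rt: "?b \<in> \<Phi>" using root_reflection alpha_root s b pos_root by blast
  assume "\<not> pos ?b"
  then have "pos (- ?b)" using rt not_pos_iff by blast
  then obtain c' where c': "\<forall>d\<in>\<Delta>. 0 \<le> c' d" "- ?b = (\<Sum>d\<in>\<Delta>. c' d *\<^sub>R d)"
    unfolding pos_def by blast
  obtain c where c: "\<forall>d\<in>\<Delta>. 0 \<le> c d" "b = (\<Sum>d\<in>\<Delta>. c d *\<^sub>R d)"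
    using b unfolding pos_def by blast
  obtain t where t: "?b = b - t *\<^sub>R \<alpha> s" by (auto simp: reflection_def)
  have "b - t *\<^sub>R \<alpha> s = (\<Sum>d\<in>\<Delta>. (c d - (if d = \<alpha> s then t else 0)) *\<^sub>R d)"
  proof -
    have "(\<Sum>d\<in>\<Delta>. (if d = \<alpha> s then t else 0) *\<^sub>R d) = (\<Sum>d\<in>\<Delta>. if d = \<alpha> s then t *\<^sub>R d else 0)"
      by (rule sum.cong) auto
    also have "\<dots> = t *\<^sub>R \<alpha> s" using finite_\<Delta> s by (auto simp: sum.delta')
    finally show ?thesis using c(2) by (simp add: scaleR_diff_left sum_subtractf)
  qed
  moreover have "?b = (\<Sum>d\<in>\<Delta>. (- c' d) *\<^sub>R d)"
    using c'(2) by (metis (no_types, lifting) minus_minus scaleR_minus_left sum.cong sum_negf)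
  ultimately have eq: "(\<Sum>d\<in>\<Delta>. (c d - (if d = \<alpha> s then t else 0)) *\<^sub>R d) = (\<Sum>d\<in>\<Delta>. (- c' d) *\<^sub>R d)"
    using t by simp
  have zero: "c d = 0" if "d \<in> \<Delta>" "d \<noteq> \<alpha> s" for d
    using coeff_unique[OF eq that(1)] that c(1) c'(1) by force
  have "(\<Sum>d\<in>\<Delta>. c d *\<^sub>R d) = (\<Sum>d\<in>\<Delta>. if d = \<alpha> s then c d *\<^sub>R d else 0)"
    using zero by (intro sum.cong HOL.refl) simp
  then have "b = (\<Sum>d\<in>\<Delta>. if d = \<alpha> s then c d *\<^sub>R d else 0)" by (simp only: c(2)[symmetric])
  then have "b = c (\<alpha> s) *\<^sub>R \<alpha> s" using finite_\<Delta> s by (auto simp: sum.delta')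
  then have "b \<in> \<Phi> \<inter> span {\<alpha> s}" using b pos_root
    by (metis IntI span_base span_scale insertI1)
  then have "b = - \<alpha> s" using root_line[OF alpha_root[OF s]] b(2) by blast
  then show False using b(1) pos_alpha[OF s] not_pos_both by auto
qed

section \<open>Products of words and their action on roots\<close>

lemma word_prod_closed: "ws \<in> lists S \<Longrightarrow> word_prod W ws \<in> carrier W"
proof (induction ws)
  case Nil
  then show ?case using is_group by (simp add: word_prod_def group.is_monoid)
next
  case (Cons s ws)
  then show ?case using is_group S_carrier[of s]
    by (simp add: word_prod_def monoid.m_closed group.is_monoid)
qed

lemma word_prod_append:
  assumes "us \<in> lists S" "vs \<in> lists S"
  shows "word_prod W (us @ vs) = word_prod W us \<otimes> word_prod W vs"
  using assms
proof (induction us)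
  case Nil
  then show ?case using is_group word_prod_closed[of vs] 
    by (simp add: word_prod_def group.is_monoid monoid.l_one)
next
  case (Cons s us)
  then show ?case using is_group S_carrier[of s] word_prod_closed[of us] word_prod_closed[of vs]
    by (simp add: word_prod_def monoid.m_assoc group.is_monoid)
qed

lemma word_prod_single: "s \<in> S \<Longrightarrow> word_prod W [s] = s"
  using S_carrier[of s] is_group by (simp add: word_prod_def group.is_monoid monoid.r_one)

lemma word_prod_rev:
  assumes "ws \<in> lists S"
  shows "word_prod W (rev ws) = inv (word_prod W ws)"
  using assms
proof (induction ws)
  case Nil
  interpret group W by (rule is_group)
  show ?case by (simp add: word_prod_def)
next
  case (Cons s ws)
  then have s: "s \<in> S" "s \<in> carrier W" and ws: "ws \<in> lists S" "word_prod W ws \<in> carrier W"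
    and IH: "word_prod W (rev ws) = inv (word_prod W ws)"
    using S_carrier[of s] word_prod_closed[of ws] by simp_all
  interpret group W by (rule is_group)
  have "inv s = s" using S_square[OF s(1)] s(2) inv_equality by blast
  then have "inv (word_prod W (s # ws)) = inv (word_prod W ws) \<otimes> s"
    using word_prod_append[of "[s]" ws] s ws by (simp add: inv_mult_group word_prod_single)
  moreover have "word_prod W (rev (s # ws)) = inv (word_prod W ws) \<otimes> s"
    using IH ws(1) s word_prod_append[of "rev ws" "[s]"] 
    by (simp add: word_prod_single in_lists_conv_set)
  ultimately show ?case by simp
qed

lemma act_root: "ws \<in> lists S \<Longrightarrow> b \<in> \<Phi> \<Longrightarrow> act (word_prod W ws) b \<in> \<Phi>"
proof (induction ws)
  case Nil
  then show ?case by (simp add: word_prod_def act_one)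
next
  case (Cons s ws)
  have s: "s \<in> S" and ws: "ws \<in> lists S" using Cons.prems by auto
  have "act (word_prod W (s # ws)) b = reflection (\<alpha> s) (act (word_prod W ws) b)"
    using word_prod_append[of "[s]" ws] s ws act_mult[OF S_carrier[OF s] word_prod_closed[OF ws]]
    by (simp add: word_prod_single act_simple)
  then show ?case using Cons s ws root_reflection alpha_root by simp
qed

end

section \<open>Root functions of facets\<close>

lemma nths_lessThan_Suc:
  assumes "k < length xs"
  shows "nths xs ({..<Suc k} - I) = nths xs ({..<k} - I) @ (if k \<in> I then [] else [xs ! k])"
proof -
  have restrict: "nths xs ({..<h} - I) = nths (take h xs) (- I)" if "h \<le> length xs" for h
  proof -
    have "nths xs ({..<h} - I) = nths (take h xs @ drop h xs) ({..<h} - I)" by simp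
    also have "\<dots> = nths (take h xs) ({..<h} - I) @ nths (drop h xs) {}"
      unfolding nths_append using that
      by (auto intro!: arg_cong2[where f = nths])
    also have "\<dots> = nths (take h xs) (- I)"
      by (auto simp: nths_def intro!: arg_cong[where f = "map fst"] filter_cong dest!: set_zip_rightD)
    finally show ?thesis .
  qed
  show ?thesis using assms
    by (simp add: restrict take_Suc_conv_app_nth nths_append)
qed

locale subword_setting = finite_coxeter_system W S act \<Phi> \<alpha>
  for W :: "('w, 'b) monoid_scheme" (structure)
    and S :: "'w set"
    and act :: "'w \<Rightarrow> 'v::euclidean_space \<Rightarrow> 'v"
    and \<Phi> :: "'v set"
    and \<alpha> :: "'w \<Rightarrow> 'v" +
  fixes Q :: "'w list" and \<rho> :: 'w
  assumes Q_lists: "Q \<in> lists S"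
begin

abbreviation m :: nat where "m \<equiv> length Q"

abbreviation facet :: "nat set \<Rightarrow> bool" where "facet \<equiv> subword_facet W S Q \<rho>"

abbreviation r :: "nat set \<Rightarrow> nat \<Rightarrow> 'v" where "r \<equiv> root_function W act \<alpha> Q"

text \<open>The prefix product is kept as a linear map, for arbitrary \<open>I\<close>, so that
  facets can be compared by identities between maps; \<open>act_faithful\<close> leads back to the
  group in \<open>word_prod_eqI\<close>.\<close>

definition T :: "nat set \<Rightarrow> nat \<Rightarrow> 'v \<Rightarrow> 'v" where
  "T I k = act (word_prod W (nths Q ({..<k} - I)))"

lemma nths_Q_lists: "nths Q A \<in> lists S"
  using Q_lists by (meson in_lists_conv_set notin_set_nthsI subsetD)

lemma Q_nth: "k < m \<Longrightarrow> Q ! k \<in> S"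
  using Q_lists by (simp add: in_lists_conv_set)

lemma r_eq: "r I k = T I k (\<alpha> (Q ! k))"
  by (simp add: root_function_def T_def)

lemma T_orthogonal: "orthogonal_transformation (T I k)"
  unfolding T_def by (intro act_orthogonal word_prod_closed nths_Q_lists)

lemma T_root: "b \<in> \<Phi> \<Longrightarrow> T I k b \<in> \<Phi>"
  unfolding T_def by (intro act_root nths_Q_lists)

lemma r_root: "k < m \<Longrightarrow> r I k \<in> \<Phi>"
  unfolding r_eq by (intro T_root alpha_root Q_nth)

lemma T_0: "T I 0 = id"
  by (simp add: T_def act_one word_prod_def)

lemma T_Suc_right:
  assumes "k < m"
  shows "T I (Suc k) = (if k \<in> I then T I k else T I k \<circ> reflection (\<alpha> (Q ! k)))"
  unfolding T_def nths_lessThan_Suc[OF assms]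
  using word_prod_append[of "nths Q ({..<k} - I)" "[Q ! k]"] Q_nth[OF assms]
    act_mult[OF word_prod_closed[OF nths_Q_lists] S_carrier]
  by (auto simp: nths_Q_lists word_prod_single act_simple)

text \<open>Conjugated by the prefix, the simple reflection of the letter becomes the reflection in
  its root.\<close>

lemma T_Suc:
  assumes "k < m"
  shows "T I (Suc k) = (if k \<in> I then T I k else reflection (r I k) \<circ> T I k)"
  using orthogonal_transformation_reflection[OF T_orthogonal]
  by (simp add: T_Suc_right[OF assms] r_eq)

lemma T_cong: "(\<And>h. h < k \<Longrightarrow> h \<in> I \<longleftrightarrow> h \<in> J) \<Longrightarrow> T I k = T J k"
  by (auto simp: T_def intro!: arg_cong[where f = act] arg_cong[where f = "word_prod W"]
      arg_cong2[where f = nths])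

lemma r_cong: "(\<And>h. h < k \<Longrightarrow> h \<in> I \<longleftrightarrow> h \<in> J) \<Longrightarrow> r I k = r J k"
  by (simp add: r_eq T_cong[of k I J])

text \<open>Inserting or deleting the letter at \<open>i\<close> multiplies every later prefix on
  the left by the reflection in its root; as this is an involution, one formula serves both
  directions.\<close>

lemma T_toggle:
  assumes ij: "\<And>h. h \<noteq> i \<Longrightarrow> h \<in> I \<longleftrightarrow> h \<in> J" "i \<in> I \<longleftrightarrow> i \<notin> J"
    and "i < k" "k \<le> m"
  shows "T J k = reflection (r I i) \<circ> T I k"
  using assms(3,4)
proof (induction k)
  case (Suc k)
  show ?case
  proof (cases "k = i")
    case True
    have eq: "T I i = T J i" "r I i = r J i" using ij(1) by (auto intro!: T_cong r_cong)
    have "reflection (r J i) (reflection (r J i) x) = x" for x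
      using reflection_reflection r_root[of i J] root_nonzero Suc.prems True by auto
    then show ?thesis
      using Suc.prems True ij(2) eq by (cases "i \<in> I") (simp_all add: T_Suc fun_eq_iff)
  next
    case False
    then have "T J k = reflection (r I i) \<circ> T I k" "k \<in> I \<longleftrightarrow> k \<in> J" "k < m"
      using Suc ij(1) by auto
    then show ?thesis by (cases "k \<in> I") (simp_all add: T_Suc_right fun_eq_iff)
  qed
qed simp

lemma T_toggle2:
  assumes ij: "\<And>h. h \<noteq> i \<Longrightarrow> h \<noteq> j \<Longrightarrow> h \<in> I \<longleftrightarrow> h \<in> J" "i \<in> I \<longleftrightarrow> i \<notin> J" "j \<in> I \<longleftrightarrow> j \<notin> J"
    and "i < j" "j < k" "k \<le> m"
  shows "T J k = reflection (r I i) \<circ> reflection (r I j) \<circ> T I k"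
proof -
  \<comment> \<open>\<open>H\<close> changes only the later position \<open>j\<close>, so the root
    at \<open>i\<close> is still that of \<open>I\<close>.\<close>
  define H where "H = (if j \<in> I then I - {j} else insert j I)"
  have H: "\<And>h. h \<noteq> j \<Longrightarrow> h \<in> I \<longleftrightarrow> h \<in> H" "j \<in> I \<longleftrightarrow> j \<notin> H"
    by (auto simp: H_def)
  have "T H k = reflection (r I j) \<circ> T I k"
    using T_toggle[of j I H k] H assms by blast
  moreover have "T J k = reflection (r H i) \<circ> T H k"
    using T_toggle[of i H J k] H assms by (metis less_irrefl less_trans)
  moreover have "r H i = r I i" using H(1) \<open>i < j\<close> by (auto intro!: r_cong)
  ultimately show ?thesis by (simp add: comp_assoc)
qed

lemma r_toggle:
  assumes "\<And>h. h \<noteq> i \<Longrightarrow> h < k \<Longrightarrow> h \<in> I \<longleftrightarrow> h \<in> J" "i \<in> I \<longleftrightarrow> i \<notin> J" "i < k" "k < m"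
  shows "r J k = reflection (r I i) (r I k)"
proof -
  \<comment> \<open>Agreement is assumed only below \<open>k\<close>, whereas
    \<open>T_toggle\<close> asks for it everywhere; \<open>J'\<close> continues \<open>J\<close> by
    \<open>I\<close> from \<open>k\<close> on.\<close>
  define J' where "J' = {h. if h < k then h \<in> J else h \<in> I}"
  have "T J k = T J' k" by (rule T_cong) (simp add: J'_def)
  moreover have "T J' k = reflection (r I i) \<circ> T I k"
    using assms by (intro T_toggle) (auto simp: J'_def)
  ultimately show ?thesis by (simp add: r_eq)
qed

text \<open>The two toggles contribute the same reflection twice. Consequently a flip does not alter
  the root function beyond the inserted position.\<close>

lemma r_toggle2:
  assumes "\<And>h. h \<noteq> i \<Longrightarrow> h \<noteq> j \<Longrightarrow> h < k \<Longrightarrow> h \<in> I \<longleftrightarrow> h \<in> J"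
    and "i \<in> I \<longleftrightarrow> i \<notin> J" "j \<in> I \<longleftrightarrow> j \<notin> J"
    and "i < j" "j < k" "k < m" "r I i = r I j"
  shows "r J k = r I k"
proof -
  define J' where "J' = {h. if h < k then h \<in> J else h \<in> I}"
  have "T J k = T J' k" by (rule T_cong) (simp add: J'_def)
  moreover have "T J' k = reflection (r I i) \<circ> reflection (r I j) \<circ> T I k"
    using assms by (intro T_toggle2) (auto simp: J'_def)
  moreover have "reflection (r I i) \<circ> reflection (r I j) = id"
    using assms r_root root_nonzero by (metis reflection_comp_reflection less_trans)
  ultimately show ?thesis by (simp add: r_eq)
qed

section \<open>Facets as reduced words, their inversions and their flips\<close>

lemma facet_subset: "facet I \<Longrightarrow> I \<subseteq> {..<m}"
  by (simp add: subword_facet_def)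

lemma length_nths_Q: "length (nths Q ({..<m} - I)) = card ({..<m} - I)"
  unfolding length_nths by (rule arg_cong[where f = card]) auto

lemma word_prod_eqI:
  assumes "T I m = T J m"
  shows "word_prod W (nths Q ({..<m} - I)) = word_prod W (nths Q ({..<m} - J))"
  using assms act_faithful word_prod_closed[OF nths_Q_lists] unfolding T_def inj_on_def by blast

lemma facet_T: "facet I \<Longrightarrow> T I m = act \<rho>"
  by (simp add: T_def subword_facet_def reduced_expression_def)

lemma facet_minimal:
  assumes "facet I" "T J m = T I m"
  shows "card ({..<m} - I) \<le> card ({..<m} - J)"
proof -
  have "coxeter_length W S \<rho> \<le> card ({..<m} - J)"
    unfolding coxeter_length_def
    using assms word_prod_eqI[OF assms(2)] nths_Q_lists[of "{..<m} - J"] length_nths_Q[of J]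
    by (intro Least_le) (auto simp: subword_facet_def reduced_expression_def)
  then show ?thesis
    using assms(1) length_nths_Q[of I] by (simp add: subword_facet_def reduced_expression_def)
qed

lemma facet_exchangeI:
  assumes "facet I" "T J m = T I m" "J \<subseteq> {..<m}" "card J = card I"
  shows "facet J"
proof -
  have "card ({..<m} - J) = card ({..<m} - I)"
    using assms facet_subset[OF assms(1)] by (simp add: card_Diff_subset finite_subset)
  then show ?thesis
    using assms word_prod_eqI[OF assms(2)] nths_Q_lists[of "{..<m} - J"]
      length_nths_Q[of J] length_nths_Q[of I]
    by (simp add: subword_facet_def reduced_expression_def)
qed

text \<open>Deletion argument: two used letters with the same root up to sign could both be dropped
  without changing the product, against reducedness.\<close>

lemma facet_no_repeat:
  assumes I: "facet I" and "i < j" "j < m" "i \<notin> I" "j \<notin> I"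
    and eq: "r I j = r I i \<or> r I j = - r I i"
  shows False
proof -
  let ?J = "I \<union> {i, j}"
  have "reflection (r I i) \<circ> reflection (r I j) = id"
  proof -
    have "reflection (r I j) = reflection (r I i)" using eq reflection_uminus by metis
    moreover have "r I i \<noteq> 0" using r_root[of i I] root_nonzero assms(2,3) by simp
    ultimately show ?thesis by (simp add: reflection_comp_reflection)
  qed
  then have "T ?J m = T I m"
    using T_toggle2[of i j I ?J m] assms by auto
  then have "card ({..<m} - I) \<le> card ({..<m} - ?J)" using facet_minimal[OF I] by blast
  moreover have "card ({..<m} - ?J) < card ({..<m} - I)"
    using assms by (intro psubset_card_mono) auto
  ultimately show False by simp
qed

text \<open>A root changes sign along the prefixes only at a letter of which it is the root.\<close>

lemma sign_change:
  assumes "T I a x = b" "pos x" "T I c y = b" "\<not> pos y" "a \<le> c" "c \<le> m"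
  shows "\<exists>h. a \<le> h \<and> h < c \<and> h \<notin> I \<and> r I h = b"
  using assms(5,6,3,4)
proof (induction c arbitrary: y)
  case 0
  then show ?case using assms(1,2) by (simp add: T_0)
next
  case (Suc c)
  show ?case
  proof (cases "a = Suc c")
    case True
    then have "x = y"
      using assms(1) Suc.prems orthogonal_transformation_inj[OF T_orthogonal] by (metis injD)
    then show ?thesis using assms(2) Suc.prems by blast
  next
    case False
    then have c: "a \<le> c" "c \<le> m" "c < m" using Suc.prems by auto
    have s: "Q ! c \<in> S" using Q_nth c by blast
    show ?thesis
    proof (cases "c \<in> I")
      case True
      then show ?thesis using Suc c by (auto simp: T_Suc less_Suc_eq)
    next
      case c_used: False
      \<comment> \<open>\<open>z\<close> is the preimage of \<open>b\<close> one letter earlier. If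
        it is positive while \<open>y\<close> is not, the letter reverses its sign, and a simple
        reflection does this only to its own simple root.\<close>
      define z where "z = reflection (\<alpha> (Q ! c)) y"
      have z: "T I c z = b" using Suc.prems c c_used by (simp add: T_Suc_right z_def)
      show ?thesis
      proof (cases "pos z")
        case True
        have "y = reflection (\<alpha> (Q ! c)) z"
          unfolding z_def using reflection_reflection root_nonzero alpha_root s by metis
        then have "z = \<alpha> (Q ! c)" using pos_reflection_simple[OF s True] Suc.prems by auto
        then have "r I c = b" using z by (simp add: r_eq)
        then show ?thesis using c c_used by auto
      next
        case False
        then show ?thesis using Suc.IH[OF c(1,2) z] by (auto simp: less_Suc_eq)
      qed
    qed
  qed
qed

lemma T_preimage: "b \<in> \<Phi> \<Longrightarrow> k \<le> m \<Longrightarrow> \<exists>x\<in>\<Phi>. T I k x = b"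
proof (induction k arbitrary: b)
  case 0
  then show ?case by (auto simp: T_0)
next
  case (Suc k)
  then obtain x where x: "x \<in> \<Phi>" "T I k x = b" by auto
  have s: "\<alpha> (Q ! k) \<in> \<Phi>" "\<alpha> (Q ! k) \<noteq> 0" using Suc.prems alpha_root Q_nth root_nonzero by auto
  show ?case
  proof (cases "k \<in> I")
    case True
    then show ?thesis using x Suc.prems by (auto simp: T_Suc)
  next
    case False
    then have "T I (Suc k) (reflection (\<alpha> (Q ! k)) x) = b"
      using x Suc.prems s by (simp add: T_Suc_right reflection_reflection)
    then show ?thesis using root_reflection[OF s(1) x(1)] by blast
  qed
qed

text \<open>If the root were negative, its negative would start out positive and be pulled back to
  \<open>- \<alpha> (Q ! k)\<close> at \<open>k\<close>. By \<open>sign_change\<close> it would be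
  the root of an earlier used letter, which \<open>facet_no_repeat\<close> forbids.\<close>

lemma facet_pos:
  assumes "facet I" "k < m" "k \<notin> I"
  shows "pos (r I k)"
proof (rule ccontr)
  assume "\<not> pos (r I k)"
  then have "pos (- r I k)" using not_pos_iff r_root assms(2) by blast
  moreover have "T I k (- \<alpha> (Q ! k)) = - r I k"
    using T_orthogonal[of I k] by (simp add: r_eq orthogonal_transformation_def linear_neg)
  moreover have "\<not> pos (- \<alpha> (Q ! k))" using pos_alpha Q_nth assms(2) not_pos_both by blast
  ultimately obtain h where "h < k" "h \<notin> I" "r I h = - r I k"
    using sign_change[of I 0 "- r I k" "- r I k" k "- \<alpha> (Q ! k)"] assms(2) by (auto simp: T_0)
  then show False using facet_no_repeat[OF assms(1), of h k] assms by auto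
qed

lemma facet_r_inj:
  assumes "facet I" "j < m" "k < m" "j \<notin> I" "k \<notin> I" "r I j = r I k"
  shows "j = k"
  using facet_no_repeat[OF assms(1), of j k] facet_no_repeat[OF assms(1), of k j] assms
  by (metis nat_neq_iff)

text \<open>The roots at the positions outside a facet are the inversions of \<open>\<rho>\<close>, so their set does
  not depend on the facet.\<close>

lemma facet_inversions:
  assumes I: "facet I"
  shows "(\<exists>k<m. k \<notin> I \<and> r I k = b) \<longleftrightarrow> pos b \<and> (\<exists>x. act \<rho> x = b \<and> pos (- x))"
proof
  assume "\<exists>k<m. k \<notin> I \<and> r I k = b"
  then obtain k where k: "k < m" "k \<notin> I" "r I k = b" by blast
  have b: "pos b" using facet_pos[OF I] k by blast
  obtain x where x: "x \<in> \<Phi>" "T I m x = b" using T_preimage[of b m I] b pos_root by blast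
  \<comment> \<open>Just after \<open>k\<close> the preimage of \<open>- b\<close> is a simple root.
    If \<open>x\<close> were positive, this preimage would end up negative, so a later used letter
    would have root \<open>- b\<close>.\<close>
  have "\<not> pos x"
  proof
    assume "pos x"
    let ?s = "\<alpha> (Q ! k)"
    have s: "pos ?s" using pos_alpha Q_nth k by blast
    have lin: "linear (T I h)" for h using T_orthogonal by (simp add: orthogonal_transformation_def)
    have "T I (Suc k) (- ?s) = b"
      using k reflection_self[of ?s] root_nonzero[OF pos_root[OF s]] 
        linear_neg[OF linear_reflection, of ?s ?s]
      by (simp add: T_Suc_right r_eq)
    then have "T I (Suc k) ?s = - b" using linear_neg[OF lin, of "Suc k" ?s] by (metis minus_equation_iff)
    moreover have "T I m (- x) = - b" using linear_neg[OF lin] x by simp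
    ultimately obtain h where "Suc k \<le> h" "h < m" "h \<notin> I" "r I h = - b"
      using sign_change[of I "Suc k" ?s "- b" m "- x"] s \<open>pos x\<close> not_pos_both k by auto
    then show False using facet_no_repeat[OF I, of k h] k by auto
  qed
  then show "pos b \<and> (\<exists>x. act \<rho> x = b \<and> pos (- x))"
    using b x not_pos_iff facet_T[OF I] by auto
next
  assume "pos b \<and> (\<exists>x. act \<rho> x = b \<and> pos (- x))"
  then obtain x where "pos b" "T I m x = b" "\<not> pos x"
    using facet_T[OF I] not_pos_both by (metis minus_minus)
  then show "\<exists>k<m. k \<notin> I \<and> r I k = b"
    using sign_change[of I 0 b b m x] by (auto simp: T_0)
qed

text \<open>Equal roots cancel, so the exchange preserves both the product and the number of
  letters. If \<open>j\<close> came first, its removal from the word would make the root at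
  \<open>i\<close> negative in the new facet, which uses \<open>i\<close>.\<close>

lemma facet_flip:
  assumes I: "facet I" and "i \<in> I" "j \<notin> I" "j < m" and eq: "r I i = r I j"
  shows "i < j" "facet (insert j (I - {i}))"
proof -
  let ?J = "insert j (I - {i})"
  have im: "i < m" using facet_subset[OF I] assms by auto
  have "i \<noteq> j" using assms by blast
  have "reflection (r I j) \<circ> reflection (r I j) = id"
    using reflection_comp_reflection r_root root_nonzero assms by blast
  then have "T ?J m = T I m"
    using T_toggle2[of i j I ?J m] T_toggle2[of j i I ?J m] assms im \<open>i \<noteq> j\<close>
    by (cases "i < j") auto
  moreover have "card ?J = card I"
    using assms facet_subset[OF I] by (metis Diff_iff card.remove card_insert_disjoint finite_Diff finite_lessThan finite_subset)
  ultimately show J: "facet ?J"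
    using facet_exchangeI[OF I] facet_subset[OF I] assms by blast
  show "i < j"
  proof (rule ccontr)
    assume "\<not> i < j"
    then have "j < i" using \<open>i \<noteq> j\<close> by simp
    then have "r ?J i = reflection (r I j) (r I i)"
      using assms im by (intro r_toggle) auto
    then have "r ?J i = - r I j" using eq reflection_self root_nonzero r_root assms by metis
    then show False
      using facet_pos[OF J, of i] facet_pos[OF I, of j] not_pos_both im assms \<open>i \<noteq> j\<close> by auto
  qed
qed

text \<open>As both words have product \<open>\<rho>\<close>, the two reflections agree and the
  roots are equal up to sign. Both are positive: \<open>j\<close> is used in \<open>I\<close>, and
  \<open>i\<close> is used in the new facet with the same root.\<close>

lemma facet_flip_roots:
  assumes I: "facet I" and J: "facet (insert j (I - {i}))" and "i \<in> I" "j \<notin> I" "i < j"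
  shows "r I i = r I j"
proof -
  let ?J = "insert j (I - {i})"
  have jm: "j < m" using facet_subset[OF J] by auto
  have "T ?J m = reflection (r I i) \<circ> reflection (r I j) \<circ> T I m"
    using assms jm by (intro T_toggle2) auto
  then have "T I m = reflection (r I i) \<circ> reflection (r I j) \<circ> T I m"
    using facet_T I J by metis
  then have "reflection (r I i) (reflection (r I j) (T I m x)) = T I m x" for x
    by (metis comp_apply)
  then have "reflection (r I i) (reflection (r I j) x) = x" for x
    using orthogonal_transformation_surj[OF T_orthogonal] by (metis surjD)
  then have "reflection (r I i) x = reflection (r I j) x" for x
    using reflection_reflection r_root root_nonzero \<open>i < j\<close> jm by (metis less_trans)
  then have "r I j = r I i \<or> r I j = - r I i"
    using reflection_eq_imp r_root \<open>i < j\<close> jm by (meson less_trans ext)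
  moreover have "pos (r I j)" using facet_pos[OF I] jm assms by blast
  moreover have "r I i = r ?J i" using assms by (intro r_cong) auto
  moreover have "pos (r ?J i)" using facet_pos[OF J] jm assms by auto
  ultimately show ?thesis using not_pos_both by (metis minus_minus)
qed

text \<open>The root at \<open>i\<close> is an inversion of \<open>\<rho>\<close>, as seen in
  \<open>J\<close>, so a used letter of \<open>I\<close> carries it as well.\<close>

lemma facet_flippable:
  assumes I: "facet I" and J: "facet J" and "i \<in> I" "k < m" "k \<notin> J" "r I i = r J k"
  shows "\<exists>j. j \<notin> I \<and> i < j \<and> facet (insert j (I - {i}))"
proof -
  obtain j where "j < m" "j \<notin> I" "r I j = r I i"
    using facet_inversions[OF I] facet_inversions[OF J] assms by metis
  then show ?thesis using facet_flip[OF I \<open>i \<in> I\<close>] by metis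
qed

text \<open>At the first difference of two facets, the one containing that position can flip it: the
  root there is the same in both, and the other facet uses it.\<close>

lemma facet_flippable_of_agree:
  assumes "facet I" "facet J" "i \<in> I" "i \<notin> J" "\<And>h. h < i \<Longrightarrow> h \<in> I \<longleftrightarrow> h \<in> J"
  shows "\<exists>j. j \<notin> I \<and> i < j \<and> facet (insert j (I - {i}))"
  using facet_flippable[of I J i i] facet_subset[of I] r_cong[of i I J] assms by auto

section \<open>Increasing flips and paths\<close>

text \<open>Both exchanged positions are arguments, so the definite descriptions in the labels are
  unfolded only in \<open>p_label_flip\<close> and \<open>n_label_flip\<close>.\<close>

definition flip :: "nat set \<Rightarrow> nat \<Rightarrow> nat \<Rightarrow> nat set \<Rightarrow> bool" where
  "flip I i j J \<longleftrightarrow> facet I \<and> facet J \<and> i \<in> I \<and> j \<notin> I \<and> i < j \<and> J = insert j (I - {i})"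

abbreviation path :: "nat set \<Rightarrow> (nat set \<times> nat set) list \<Rightarrow> nat set \<Rightarrow> bool" where
  "path \<equiv> flip_path W S Q \<rho>"

lemma exchange_iff: "exchange I i j J \<longleftrightarrow> i \<in> I \<and> j \<notin> I \<and> J = insert j (I - {i})"
  unfolding exchange_def by blast

lemma flip_iff_exchange: "flip I i j J \<longleftrightarrow> facet I \<and> facet J \<and> exchange I i j J \<and> i < j"
  unfolding flip_def exchange_iff by blast

lemma flip_roots: "flip I i j J \<Longrightarrow> r I i = r I j"
  unfolding flip_def using facet_flip_roots by blast

lemma flip_less: "flip I i j J \<Longrightarrow> i < m \<and> j < m"
  unfolding flip_def using facet_subset by blast

text \<open>Used letters have distinct roots, so only one of them can be exchanged with
  \<open>i\<close>.\<close>

lemma flip_unique: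
  assumes "flip I i j J" "flip I i k K"
  shows "k = j" "K = J"
proof -
  show "k = j"
    using facet_r_inj[of I k j] flip_roots[OF assms(1)] flip_roots[OF assms(2)]
      flip_less[OF assms(1)] flip_less[OF assms(2)] assms unfolding flip_def by simp
  then show "K = J" using assms unfolding flip_def by simp
qed

lemma p_label_flip: "flip I i j J \<Longrightarrow> p_label (I, J) = i"
  unfolding p_label_def flip_def exchange_iff by (rule the_equality) auto

lemma n_label_flip: "flip I i j J \<Longrightarrow> n_label (I, J) = j"
  unfolding n_label_def flip_def exchange_iff by (rule the_equality) auto

lemma path_Nil: "path I [] J \<longleftrightarrow> facet I \<and> I = J"
  by (auto simp: flip_path_def pre_digraph.awalk_def pre_digraph.cas.simps with_proj_def
      increasing_flip_graph_def)

lemma path_Cons: "path I (e # P) J \<longleftrightarrow> (\<exists>i j K. e = (I, K) \<and> flip I i j K \<and> path K P J)"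
  by (cases e) (auto simp: flip_path_def pre_digraph.awalk_def pre_digraph.cas.simps with_proj_def
      increasing_flip_graph_def flip_iff_exchange)

lemma path_append: "path I P K \<Longrightarrow> path K P' J \<Longrightarrow> path I (P @ P') J"
  by (induction P arbitrary: I) (auto simp: path_Nil path_Cons)

lemma path_facet: "path I P J \<Longrightarrow> facet I \<and> facet J"
  by (induction P arbitrary: I) (auto simp: path_Nil path_Cons flip_def)

lemma facet_finite: "facet I \<Longrightarrow> finite I"
  using facet_subset finite_subset by blast

lemma flip_sum:
  assumes "flip I i j J"
  shows "\<Sum>I < \<Sum>J"
proof -
  have "finite I" "i \<in> I" "j \<notin> I" "i < j" "J = insert j (I - {i})"
    using assms facet_finite unfolding flip_def by auto
  moreover from this have "\<Sum>I = i + \<Sum>(I - {i})" by (simp add: sum.remove)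
  ultimately show ?thesis by simp
qed

lemma flip_measure:
  assumes "flip I i j J"
  shows "\<Sum>{..<m} - \<Sum>J < \<Sum>{..<m} - \<Sum>I"
proof -
  have "\<Sum>J \<le> \<Sum>{..<m}"
    using assms facet_subset unfolding flip_def by (intro sum_mono2) auto
  then show ?thesis using flip_sum[OF assms] by simp
qed

text \<open>Flips raise the sum of positions, which is bounded by that of \<open>{..<m}\<close>;
  hence a property may be assumed for all facets one flip further on.\<close>

lemma flip_induct [consumes 1, case_names facet]:
  assumes "facet I" and "\<And>I. facet I \<Longrightarrow> (\<And>i j J. flip I i j J \<Longrightarrow> R J) \<Longrightarrow> R I"
  shows "R I"
  using assms(1)
proof (induction "\<Sum>{..<m} - \<Sum>I" arbitrary: I rule: less_induct)
  case less
  show ?case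
    using less(1)[OF flip_measure] assms(2)[OF less(2)] flip_def by blast
qed

lemma path_sum: "path I P J \<Longrightarrow> \<Sum>I + length P \<le> \<Sum>J"
  by (induction P arbitrary: I) (fastforce simp: path_Nil path_Cons dest: flip_sum)+

text \<open>Each flip removes a single position. Falling paths will attain this bound.\<close>

lemma path_card: "path I P J \<Longrightarrow> card (I - J) \<le> length P"
proof (induction P arbitrary: I)
  case Nil
  then show ?case by (simp add: path_Nil)
next
  case (Cons e P)
  then obtain i j K where K: "flip I i j K" "path K P J" by (auto simp: path_Cons)
  then have "finite K" using facet_finite unfolding flip_def by blast
  have "card (I - J) \<le> card (insert i (K - J))"
    using K \<open>finite K\<close> by (intro card_mono) (auto simp: flip_def)
  also have "\<dots> \<le> Suc (card (K - J))" by (rule card_insert_le_m1) auto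
  finally show ?case using Cons.IH[OF K(2)] by simp
qed

lemma path_agree:
  assumes "path I P J" "\<forall>e\<in>set P. k \<le> p_label e" "h < k"
  shows "h \<in> I \<longleftrightarrow> h \<in> J"
  using assms
proof (induction P arbitrary: I)
  case Nil
  then show ?case by (simp add: path_Nil)
next
  case (Cons e P)
  then obtain i j K where K: "e = (I, K)" "flip I i j K" "path K P J" by (auto simp: path_Cons)
  then have "k \<le> i" using Cons.prems p_label_flip by auto
  then have "h \<in> I \<longleftrightarrow> h \<in> K" using K(2) Cons.prems(3) by (auto simp: flip_def)
  then show ?case using Cons K by simp
qed

lemma path_stays_out:
  assumes "path I P J" "\<forall>e\<in>set P. k \<le> p_label e" "k \<notin> I"
  shows "k \<notin> J"
  using assms
proof (induction P arbitrary: I)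
  case Nil
  then show ?case by (simp add: path_Nil)
next
  case (Cons e P)
  then obtain i j K where K: "e = (I, K)" "flip I i j K" "path K P J" by (auto simp: path_Cons)
  then have "k \<le> i" using Cons.prems p_label_flip by auto
  then have "k \<notin> K" using K(2) Cons.prems(3) by (auto simp: flip_def)
  then show ?case using Cons K by simp
qed

text \<open>Inserted positions exceed the label of their flip, so neither the least label
  \<open>k\<close> nor anything below it is ever inserted: \<open>k\<close> is present until it is
  flipped out and absent afterwards.\<close>

lemma path_min_label:
  assumes "path I P J" "\<forall>e\<in>set P. k \<le> p_label e" "e \<in> set P" "p_label e = k"
  shows "k \<in> I" "k \<notin> J"
  using assms
proof (induction P arbitrary: I)
  case (Cons e' P)
  case 1
  then obtain i j K where K: "e' = (I, K)" "flip I i j K" "path K P J" by (auto simp: path_Cons)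
  then have i: "p_label e' = i" using p_label_flip by simp
  show ?case
  proof (cases "i = k")
    case True
    then show ?thesis using K by (simp add: flip_def)
  next
    case False
    then have "k \<in> K" "k < i" using Cons(1)[OF K(3)] 1 i by force+
    then show ?thesis using K(2) by (auto simp: flip_def)
  qed
next
  case (Cons e' P)
  case 2
  then obtain i j K where K: "e' = (I, K)" "flip I i j K" "path K P J" by (auto simp: path_Cons)
  then have i: "p_label e' = i" using p_label_flip by simp
  show ?case
  proof (cases "i = k")
    case True
    then have "k \<notin> K" using K by (auto simp: flip_def)
    then show ?thesis using path_stays_out[OF K(3)] 2 by simp
  next
    case False
    then show ?thesis using Cons(2)[OF K(3)] 2 i by force
  qed
qed auto

lemma path_min_label_exists:
  assumes "path I P J" "P \<noteq> []"
  obtains k where "k \<in> I" "k \<notin> J" "\<forall>e\<in>set P. k \<le> p_label e"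
proof -
  define k where "k = Min (p_label ` set P)"
  have "k \<in> p_label ` set P" unfolding k_def using assms(2) by (intro Min_in) auto
  moreover have "\<forall>e\<in>set P. k \<le> p_label e" unfolding k_def by simp
  ultimately show ?thesis using path_min_label[OF assms(1)] that by blast
qed

lemma path_labels_ge:
  assumes "path I P J" "\<And>h. h < k \<Longrightarrow> h \<in> I \<longleftrightarrow> h \<in> J"
  shows "\<forall>e\<in>set P. k \<le> p_label e"
proof (cases "P = []")
  case False
  then show ?thesis
    using path_min_label_exists[OF assms(1)] assms(2) by (metis le_trans not_le_imp_less)
qed simp

section \<open>Sinks among the facets containing a fixed set\<close>

lemma path_to_sink:
  assumes "facet I" "F \<subseteq> I"
  shows "\<exists>P Z. path I P Z \<and> F \<subseteq> Z \<and> \<not> (\<exists>i j K. i \<in> Z - F \<and> flip Z i j K)"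
  using assms
proof (induction rule: flip_induct)
  case (facet I)
  show ?case
  proof (cases "\<exists>i j K. i \<in> I - F \<and> flip I i j K")
    case True
    then obtain i j K where K: "i \<in> I - F" "flip I i j K" by blast
    moreover have "F \<subseteq> K" using K facet.prems by (auto simp: flip_def)
    ultimately show ?thesis using facet.IH[OF K(2)] by (meson path_Cons)
  next
    case False
    then show ?thesis using facet path_Nil by blast
  qed
qed

text \<open>At the first position where they differ, which is not in \<open>F\<close>, one of the
  two facets could still be flipped by \<open>facet_flippable_of_agree\<close>.\<close>

lemma sink_unique:
  assumes "facet Z" "F \<subseteq> Z" "\<And>i j K. i \<in> Z - F \<Longrightarrow> \<not> flip Z i j K"
    and "facet L" "F \<subseteq> L" "\<And>i j K. i \<in> L - F \<Longrightarrow> \<not> flip L i j K"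
  shows "Z = L"
proof (rule ccontr)
  assume "Z \<noteq> L"
  then have ex: "\<exists>k. (k \<in> Z) \<noteq> (k \<in> L)" by blast
  define k where "k = (LEAST k. (k \<in> Z) \<noteq> (k \<in> L))"
  have k: "(k \<in> Z) \<noteq> (k \<in> L)" unfolding k_def by (rule LeastI_ex[OF ex])
  have agree: "h \<in> Z \<longleftrightarrow> h \<in> L" if "h < k" for h using not_less_Least that unfolding k_def by blast
  show False
  proof (cases "k \<in> Z")
    case True
    then obtain j where "j \<notin> Z" "k < j" "facet (insert j (Z - {k}))"
      using facet_flippable_of_agree[of Z L k] assms k agree by blast
    then have "flip Z k j (insert j (Z - {k}))" using True assms by (simp add: flip_def)
    then show False using assms True k by blast
  next
    case False
    then obtain j where "j \<notin> L" "k < j" "facet (insert j (L - {k}))"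
      using facet_flippable_of_agree[of L Z k] assms k agree by blast
    then have "flip L k j (insert j (L - {k}))" using False k assms by (simp add: flip_def)
    then show False using assms False k by blast
  qed
qed

section \<open>Rising paths\<close>

lemma p_rising_unique:
  assumes "path I P J" "rising p_label P" "path I P' J" "rising p_label P'"
  shows "P = P'"
  using assms
proof (induction P arbitrary: I P')
  case Nil
  then show ?case using path_sum[of I P' J] by (auto simp: path_Nil)
next
  case (Cons e P)
  then obtain i j K where K: "e = (I, K)" "flip I i j K" "path K P J" by (auto simp: path_Cons)
  have "P' \<noteq> []" using Cons.prems path_sum[of I "e # P" J] by (auto simp: path_Nil)
  then obtain e' R where P': "P' = e' # R" by (cases P') auto
  then obtain i' j' K' where K': "e' = (I, K')" "flip I i' j' K'" "path K' R J"
    using Cons.prems by (auto simp: path_Cons)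
  have lab: "p_label e = i" "p_label e' = i'" using K K' p_label_flip by auto
  have ge: "\<forall>f\<in>set (e # P). i \<le> p_label f" "\<forall>f\<in>set P'. i' \<le> p_label f"
    using Cons.prems lab P' by (auto simp: rising_def sorted_wrt_map less_imp_le)
  have "i \<in> I" "i \<notin> J" "i' \<in> I" "i' \<notin> J"
    using path_min_label[OF Cons.prems(1) ge(1), of e] path_min_label[OF Cons.prems(3) ge(2), of e']
      lab P' by auto
  \<comment> \<open>If \<open>i < i'\<close>, then \<open>P'\<close> never touches \<open>i\<close>,
    although \<open>I\<close> and \<open>J\<close> differ there; likewise with the roles
    exchanged.\<close>
  then have "i = i'"
    using path_agree[OF Cons.prems(1) ge(1), of i'] path_agree[OF Cons.prems(3) ge(2), of i]
    by (metis linorder_neqE_nat)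
  then have "K' = K" using flip_unique K(2) K'(2) by blast
  then show ?case
    using Cons.IH[OF K(3), of R] Cons.prems K K' P' by (auto simp: rising_def)
qed

text \<open>Any \<open>x\<close> in \<open>I\<close> with the root of \<open>z\<close> can be
  exchanged with the same \<open>j\<close>, so both positions are flippable.\<close>

lemma double_root_freeD:
  assumes "double_root_free W S act \<alpha> Q \<rho>" "flip I z j J" "x \<in> I" "x \<noteq> z" "r I x = r I z"
  shows False
proof -
  have "j \<notin> I" "facet I" "z \<in> I" "j < m" "r I z = r I j"
    using assms(2) flip_roots flip_less by (auto simp: flip_def)
  then have "facet (insert j (I - {z}))" "facet (insert j (I - {x}))"
    using facet_flip assms by metis+
  then have "flippable W S Q \<rho> I z" "flippable W S Q \<rho> I x"
    using \<open>j \<notin> I\<close> \<open>z \<in> I\<close> assms(3) unfolding flippable_def exchange_iff by blast+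
  then show False using assms \<open>facet I\<close> unfolding double_root_free_def by blast
qed

text \<open>The flips of \<open>a\<close> and \<open>i\<close> span a polygon; its other side is at least as long as the side
  given. Double roots are the one exception, where it consists of a single edge.\<close>

lemma polygon:
  assumes drf: "double_root_free W S act \<alpha> Q \<rho>"
    and IK: "flip I a b K" and KL: "flip K i j L" and "i < a"
  shows "\<exists>j' I' P. flip I i j' I' \<and> path I' P L \<and> P \<noteq> []"
proof -
  have I: "facet I" "a \<in> I" "b \<notin> I" "a < b" "K = insert b (I - {a})" "facet K"
    and L: "facet L" "i \<in> K" "j \<notin> K" "i < j" "L = insert j (K - {i})"
    using IK KL by (auto simp: flip_def)
  have less: "a < m" "b < m" "i < m" "j < m" using flip_less IK KL by blast+
  have iI: "i \<in> I" using I L \<open>i < a\<close> by auto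
  have ri: "r I i = r K i" using I \<open>i < a\<close> by (intro r_cong) auto
  have "j \<noteq> b" using I L by blast
  \<comment> \<open>This is where double roots are excluded: if the second flip inserted
    \<open>a\<close> again, then \<open>i\<close> and \<open>a\<close> would have the same root in
    \<open>I\<close>.\<close>
  have "j \<noteq> a"
  proof
    assume "j = a"
    have "r K a = r I a" using I by (intro r_cong) auto
    then have "r I i = r I a" using flip_roots[OF KL] ri \<open>j = a\<close> by simp
    then show False using double_root_freeD[OF drf IK] iI \<open>i < a\<close> by auto
  qed
  then have jI: "j \<notin> I" using L I by auto
  show ?thesis
  proof (cases "b < j")
    case True
    let ?I' = "insert j (I - {i})"
    \<comment> \<open>The position \<open>j\<close> lies beyond \<open>a\<close> and
      \<open>b\<close>, so the first flip leaves its root alone and the two flips commute.\<close>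
    have "r K j = r I j"
      using I True less flip_roots[OF IK] \<open>j \<noteq> a\<close>
      by (intro r_toggle2[of a b]) auto
    then have "r I i = r I j" using flip_roots[OF KL] ri by simp
    then have I': "flip I i j ?I'" using facet_flip I(1) iI jI less by (simp add: flip_def)
    moreover have "flip ?I' a b L"
      using I' I L iI \<open>i < a\<close> \<open>j \<noteq> b\<close> \<open>j \<noteq> a\<close> by (auto simp: flip_def)
    ultimately show ?thesis using L(1) by (metis path_Cons path_Nil list.distinct(1))
  next
    case False
    then have "j < b" using \<open>j \<noteq> b\<close> by simp
    \<comment> \<open>The polygon consists of the facets containing \<open>F\<close>; it remains to
      see that \<open>L\<close> is its sink.\<close>
    define F where "F = I - {i, a}"
    have FL: "F \<subseteq> L" "L - F \<subseteq> {j, b}" using I L by (auto simp: F_def)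
    \<comment> \<open>A flippable position has the root of a used letter, which is positive. At
      \<open>j\<close> and \<open>b\<close>, however, the roots in \<open>L\<close> are the
      negatives of positive roots, since each of these positions has been inserted by a
      flip.\<close>
    have neg: "\<not> flip L k h M" if k: "k \<in> L - F" for k h M
    proof
      assume M: "flip L k h M"
      then have h: "h \<notin> L" "h < m" "r L k = r L h" "k < h" using flip_roots flip_less by (auto simp: flip_def)
      have "pos (r L k)" using facet_pos[OF L(1)] h by simp
      have rLj: "r L j = - r K j"
      proof -
        have "r L j = reflection (r K i) (r K j)"
          using L less by (intro r_toggle) auto
        then show ?thesis
          using flip_roots[OF KL] reflection_self[OF root_nonzero[OF r_root[OF less(4), of K]]] by simp
      qed
      have "pos (r K j)" using facet_pos[OF I(6)] L less by simp
      have rLb: "r L b = r K b"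
        using L less \<open>j < b\<close> flip_roots[OF KL] by (intro r_toggle2[of i j]) auto
      have rKb: "r K b = - r I b"
      proof -
        have "r K b = reflection (r I a) (r I b)"
          using I less by (intro r_toggle) auto
        then show ?thesis
          using flip_roots[OF IK] reflection_self[OF root_nonzero[OF r_root[OF less(2), of I]]] by simp
      qed
      have "pos (r I b)" using facet_pos[OF I(1)] I less by simp
      have "k = j \<or> k = b" using FL k by blast
      then show False
        using \<open>pos (r L k)\<close> rLj rLb rKb \<open>pos (r K j)\<close> \<open>pos (r I b)\<close> not_pos_both by metis
    qed
    have "i \<notin> L" using L by auto
    have "h \<in> I \<longleftrightarrow> h \<in> L" if "h < i" for h using that I L \<open>i < a\<close> by auto
    then obtain j' where j': "j' \<notin> I" "i < j'" "facet (insert j' (I - {i}))"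
      using facet_flippable_of_agree[OF I(1) L(1) iI \<open>i \<notin> L\<close>] by blast
    define I' where "I' = insert j' (I - {i})"
    have I': "flip I i j' I'" using j' I iI by (simp add: flip_def I'_def)
    have FI': "F \<subseteq> I'" by (auto simp: F_def I'_def)
    \<comment> \<open>Flipping on inside the polygon ends in a sink, which is \<open>L\<close> by
      uniqueness. The path is not empty because \<open>a\<close> is in \<open>I'\<close> but not in
      \<open>L\<close>.\<close>
    obtain P Z where P: "path I' P Z" "F \<subseteq> Z" "\<not> (\<exists>i j K. i \<in> Z - F \<and> flip Z i j K)"
      using path_to_sink[OF _ FI'] j' I'_def by blast
    then have "Z = L" using sink_unique[OF _ P(2) _ L(1) FL(1) neg] path_facet by blast
    moreover have "a \<in> I'" "a \<notin> L" using I L \<open>i < a\<close> \<open>j \<noteq> a\<close> by (auto simp: I'_def)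
    ultimately show ?thesis using P I' path_Nil by blast
  qed
qed

text \<open>By induction the flip of \<open>i\<close> comes first in the tail;
  \<open>polygon\<close> then moves it past the first edge. The nonempty path \<open>R\<close> makes
  up for the edge that this costs.\<close>

lemma bubble_min_label:
  assumes drf: "double_root_free W S act \<alpha> Q \<rho>"
    and "path I P J" "\<forall>e\<in>set P. i \<le> p_label e" "i \<in> I" "i \<notin> J"
  shows "\<exists>j I' P'. flip I i j I' \<and> path I' P' J \<and> length P \<le> Suc (length P')"
  using assms(2-)
proof (induction P arbitrary: I)
  case Nil
  then show ?case by (simp add: path_Nil)
next
  case (Cons e P)
  then obtain a b K where K: "e = (I, K)" "flip I a b K" "path K P J" by (auto simp: path_Cons)
  then have "i \<le> a" using Cons.prems p_label_flip by auto
  show ?case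
  proof (cases "a = i")
    case True
    then show ?thesis using K by auto
  next
    case False
    then have "i \<in> K" "i < a" using K \<open>i \<le> a\<close> Cons.prems by (auto simp: flip_def)
    then obtain j L P' where L: "flip K i j L" "path L P' J" "length P \<le> Suc (length P')"
      using Cons.IH[OF K(3)] Cons.prems by auto
    obtain j' I' R where R: "flip I i j' I'" "path I' R L" "R \<noteq> []"
      using polygon[OF drf K(2) L(1) \<open>i < a\<close>] by blast
    then have "path I' (R @ P') J" using path_append L by blast
    moreover have "length (e # P) \<le> Suc (length (R @ P'))"
      using L(3) R(3) by (cases R) auto
    ultimately show ?thesis using R(1) by blast
  qed
qed

lemma p_rising_exists:
  assumes drf: "double_root_free W S act \<alpha> Q \<rho>" and "path I P J"
  shows "\<exists>R. path I R J \<and> rising p_label R \<and> length P \<le> length R"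
proof -
  have "facet I" using path_facet assms by blast
  then show ?thesis using assms(2)
  proof (induction arbitrary: P rule: flip_induct)
    case (facet I)
    show ?case
    proof (cases "P = []")
      case True
      then show ?thesis using facet.prems by (auto simp: rising_def)
    next
      case False
      then obtain i where i: "i \<in> I" "i \<notin> J" "\<forall>e\<in>set P. i \<le> p_label e"
        using path_min_label_exists facet.prems by blast
      obtain j I' P' where I': "flip I i j I'" "path I' P' J" "length P \<le> Suc (length P')"
        using bubble_min_label[OF drf facet.prems i(3,1,2)] by blast
      obtain R where R: "path I' R J" "rising p_label R" "length P' \<le> length R"
        using facet.IH[OF I'(1,2)] by blast
      \<comment> \<open>Below \<open>i\<close> nothing changes along \<open>P\<close>, and
        \<open>i\<close> itself is now absent from both \<open>I'\<close> and \<open>J\<close>;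
        hence all labels of \<open>R\<close> exceed \<open>i\<close>.\<close>
      have "h \<in> I' \<longleftrightarrow> h \<in> J" if "h < Suc i" for h
        using path_agree[OF facet.prems i(3), of h] I'(1) i that
        by (cases "h = i") (auto simp: flip_def)
      then have "\<forall>e\<in>set R. Suc i \<le> p_label e" using path_labels_ge[OF R(1)] by blast
      then have "rising p_label ((I, I') # R)"
        using R(2) p_label_flip[OF I'(1)] by (auto simp: rising_def)
      moreover have "path I ((I, I') # R) J" using I' R path_Cons by blast
      moreover have "length P \<le> length ((I, I') # R)" using I' R by simp
      ultimately show ?thesis by blast
    qed
  qed
qed

section \<open>Falling paths\<close>

text \<open>Along the path from \<open>A\<close> one can keep a facet that agrees with it below \<open>x\<close> and still contains
  \<open>x\<close>; a flip inserting \<open>x\<close> would make the root of that facet at \<open>x\<close> a double root.\<close>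

lemma label_not_reinserted:
  assumes drf: "double_root_free W S act \<alpha> Q \<rho>"
    and "path A P B" "\<forall>e\<in>set P. p_label e < x" "x \<notin> A"
    and "facet A'" "x \<in> A'" "\<And>h. h < x \<Longrightarrow> h \<in> A \<longleftrightarrow> h \<in> A'"
  shows "x \<notin> B"
  using assms(2-)
proof (induction P arbitrary: A A')
  case Nil
  then show ?case by (simp add: path_Nil)
next
  case (Cons e P)
  then obtain z n K where K: "e = (A, K)" "flip A z n K" "path K P B" by (auto simp: path_Cons)
  then have "z < x" using Cons.prems p_label_flip by auto
  have A: "facet A" "z \<in> A" "n \<notin> A" "z < n" "K = insert n (A - {z})" using K(2) by (auto simp: flip_def)
  have "n < m" using flip_less K by blast
  have r: "r A' h = r A h" if "h \<le> x" for h using that Cons.prems(6) by (intro r_cong) auto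
  have zA': "z \<in> A'" using A \<open>z < x\<close> Cons.prems by blast
  have rz: "r A' z = r A n" using r \<open>z < x\<close> flip_roots[OF K(2)] by simp
  \<comment> \<open>The companion facet \<open>A'\<close> can follow: the root of \<open>z\<close>
    is that of the used letter \<open>n\<close> of \<open>A\<close>, so \<open>z\<close> is
    flippable in \<open>A'\<close> too.\<close>
  then obtain n' where n': "n' \<notin> A'" "z < n'" "facet (insert n' (A' - {z}))"
    using facet_flippable[OF \<open>facet A'\<close> A(1) zA' \<open>n < m\<close> A(3)] by blast
  define K' where "K' = insert n' (A' - {z})"
  have flip': "flip A' z n' K'" using n' Cons.prems zA' by (simp add: flip_def K'_def)
  have "n \<noteq> x"
    using double_root_freeD[OF drf flip' \<open>x \<in> A'\<close>] r rz \<open>z < x\<close> by auto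
  have n'x: "n' \<noteq> x" using n' Cons.prems by blast
  have eq: "n' = n" if "n < x \<or> n' < x"
  proof -
    have "r A' n' = r A n" using flip_roots[OF flip'] rz by simp
    show ?thesis
    proof (cases "n < x")
      case True
      then have "n \<notin> A'" "r A' n = r A n" using A Cons.prems r by auto
      then show ?thesis
        using facet_r_inj[OF \<open>facet A'\<close>, of n' n] \<open>r A' n' = r A n\<close> n' flip_less[OF flip'] \<open>n < m\<close> by simp
    next
      case False
      then have "n' \<notin> A" "r A n' = r A n" using that n' Cons.prems r[of n'] \<open>r A' n' = r A n\<close> by auto
      then show ?thesis
        using facet_r_inj[OF A(1), of n' n] A flip_less[OF flip'] \<open>n < m\<close> by simp
    qed
  qed
  have "h \<in> K \<longleftrightarrow> h \<in> K'" if "h < x" for h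
    using that Cons.prems(6)[OF that] A(5) K'_def eq by auto
  moreover have "x \<notin> K" using A(5) Cons.prems \<open>n \<noteq> x\<close> by blast
  moreover have "x \<in> K'" "facet K'" using Cons.prems \<open>z < x\<close> n' by (auto simp: K'_def)
  ultimately show ?case using Cons.IH[OF K(3)] Cons.prems by auto
qed

lemma falling_labels:
  assumes drf: "double_root_free W S act \<alpha> Q \<rho>"
    and "path I P J" "falling p_label P"
  shows "distinct (map p_label P) \<and> p_label ` set P \<subseteq> I - J"
  using assms(2-)
proof (induction P arbitrary: I)
  case Nil
  then show ?case by simp
next
  case (Cons e P)
  then obtain i j K where K: "e = (I, K)" "flip I i j K" "path K P J" by (auto simp: path_Cons)
  have lab: "p_label e = i" using K p_label_flip by simp
  have I: "facet I" "i \<in> I" "i < j" "K = insert j (I - {i})" using K(2) by (auto simp: flip_def)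
  have le: "\<forall>f\<in>set P. p_label f \<le> i" and fall: "falling p_label P"
    using Cons.prems lab by (auto simp: falling_def)
  have IH: "distinct (map p_label P)" "p_label ` set P \<subseteq> K - J" using Cons.IH[OF K(3) fall] by auto
  have "i \<notin> K" using I by auto
  \<comment> \<open>The remaining labels lie in \<open>K\<close>, which lacks \<open>i\<close>, so
    the weak inequalities are strict.\<close>
  then have less: "\<forall>f\<in>set P. p_label f < i"
    using le IH(2) by (metis DiffD1 image_eqI le_neq_implies_less subsetD)
  \<comment> \<open>\<open>I\<close> itself is the companion facet that agrees with \<open>K\<close>
    below \<open>i\<close> and still contains \<open>i\<close>.\<close>
  then have "i \<notin> J"
    using label_not_reinserted[OF drf K(3) less \<open>i \<notin> K\<close> I(1,2)] I by auto
  moreover have "p_label f \<in> I - J" if "f \<in> set P" for f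
    using IH(2) less that I(3,4) by fastforce
  moreover have "i \<notin> p_label ` set P" using less by blast
  ultimately show ?case using IH(1) lab I(2) by auto
qed

lemma p_falling_minimal:
  assumes "double_root_free W S act \<alpha> Q \<rho>"
    and "path I P J" "falling p_label P" "path I P' J"
  shows "length P \<le> length P'"
proof -
  have P: "distinct (map p_label P)" "p_label ` set P \<subseteq> I - J"
    using falling_labels assms by blast+
  have "length P = card (p_label ` set P)" using distinct_card[OF P(1)] by simp
  also have "\<dots> \<le> card (I - J)"
    using P(2) facet_finite path_facet[OF assms(2)] by (intro card_mono) auto
  also have "\<dots> \<le> length P'" using path_card assms by blast
  finally show ?thesis .
qed

end

section \<open>Reversal of the word\<close>

lemma nths_rev: "nths (rev xs) A = rev (nths xs {i. i < length xs \<and> length xs - 1 - i \<in> A})"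
proof (induction xs)
  case (Cons x xs)
  have "{i. Suc i < length (x # xs) \<and> length (x # xs) - 1 - Suc i \<in> A} =
      {i. i < length xs \<and> length xs - 1 - i \<in> A}" by auto
  then show ?case using Cons by (simp add: nths_append nths_Cons)
qed simp

text \<open>The bound \<open>k < n\<close> keeps truncated subtraction harmless, so that
  \<open>mirror n\<close> is an involution on the subsets of \<open>{..<n}\<close>.\<close>

definition mirror :: "nat \<Rightarrow> nat set \<Rightarrow> nat set" where
  "mirror n I = {k. k < n \<and> n - 1 - k \<in> I}"

text \<open>Reflecting positions reverses the direction of each flip, so the edges are turned around
  as well as listed backwards.\<close>

definition mirror_path :: "nat \<Rightarrow> (nat set \<times> nat set) list \<Rightarrow> (nat set \<times> nat set) list" where
  "mirror_path n P = rev (map (\<lambda>(A, B). (mirror n B, mirror n A)) P)"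

lemma length_mirror_path: "length (mirror_path n P) = length P"
  by (simp add: mirror_path_def)

lemma mirror_mirror: "I \<subseteq> {..<n} \<Longrightarrow> mirror n (mirror n I) = I"
  by (auto simp: mirror_def)

lemma mirror_subset: "mirror n I \<subseteq> {..<n}"
  by (auto simp: mirror_def)

lemma mirror_exchange:
  assumes "i < n" "j < n"
  shows "mirror n (insert j (I - {i})) = insert (n - 1 - j) (mirror n I - {n - 1 - i})"
  using assms by (auto simp: mirror_def)

lemma exchange_mirror:
  assumes "I \<subseteq> {..<n}" "exchange I i j J" "j < n"
  shows "exchange (mirror n I) (n - 1 - i) (n - 1 - j) (mirror n J)"
proof -
  have *: "i \<in> I" "j \<notin> I" "J = insert j (I - {i})" using assms(2) unfolding exchange_def by blast+
  then have "i < n" using assms(1) by auto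
  then have "n - 1 - i \<in> mirror n I" "n - 1 - j \<notin> mirror n I" using * assms by (auto simp: mirror_def)
  then show ?thesis
    using mirror_exchange[OF \<open>i < n\<close> assms(3), of I] * unfolding exchange_def by auto
qed

text \<open>Reversal matches the words for \<open>w\<close> with those for its inverse, so both have
  the same length.\<close>

lemma (in finite_coxeter_system) reduced_expression_rev:
  assumes "reduced_expression W S ws w" "w \<in> carrier W"
  shows "reduced_expression W S (rev ws) (inv w)"
proof -
  interpret group W by (rule is_group)
  have "(\<exists>ws\<in>lists S. length ws = n \<and> word_prod W ws = inv w) \<longleftrightarrow>
      (\<exists>ws\<in>lists S. length ws = n \<and> word_prod W ws = w)" for n
    using word_prod_rev assms(2) by (metis inv_inv length_rev in_lists_conv_set set_rev)
  then have "coxeter_length W S (inv w) = coxeter_length W S w" by (simp add: coxeter_length_def)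
  then show ?thesis
    using assms word_prod_rev by (simp add: reduced_expression_def in_lists_conv_set)
qed

lemma (in finite_coxeter_system) subword_facet_rev:
  assumes "subword_facet W S Q \<rho> I" "\<rho> \<in> carrier W"
  shows "subword_facet W S (rev Q) (inv \<rho>) (mirror (length Q) I)"
proof -
  have "nths (rev Q) ({..<length Q} - mirror (length Q) I) = rev (nths Q ({..<length Q} - I))"
    unfolding nths_rev
    by (auto simp: mirror_def intro!: arg_cong[where f = rev] arg_cong2[where f = nths])
  then show ?thesis
    using assms reduced_expression_rev mirror_subset by (simp add: subword_facet_def)
qed

text \<open>For \<open>\<rho>\<close> in the group, \<open>inv\<close> is undone by a second
  application; reversing the complex twice therefore returns to the original one, and results
  transfer in both directions.\<close>

locale subword_complex = subword_setting W S act \<Phi> \<alpha> Q \<rho>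
  for W :: "('w, 'b) monoid_scheme" (structure)
    and S :: "'w set"
    and act :: "'w \<Rightarrow> 'v::euclidean_space \<Rightarrow> 'v"
    and \<Phi> :: "'v set"
    and \<alpha> :: "'w \<Rightarrow> 'v"
    and Q :: "'w list" and \<rho> :: 'w +
  assumes rho_carrier: "\<rho> \<in> carrier W"
begin

lemma subword_setting_rev: "subword_setting W S act \<Phi> \<alpha> (rev Q)"
  using Q_lists finite_coxeter_system_axioms
  by (simp add: subword_setting_def subword_setting_axioms_def in_lists_conv_set)

lemma subword_complex_rev: "subword_complex W S act \<Phi> \<alpha> (rev Q) (inv \<rho>)"
  using subword_setting_rev rho_carrier is_group
  by (simp add: subword_complex_def subword_complex_axioms_def group.inv_closed)

interpretation reversed: subword_complex W S act \<Phi> \<alpha> "rev Q" "inv \<rho>"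
  by (rule subword_complex_rev)

abbreviation mir :: "nat set \<Rightarrow> nat set" where "mir \<equiv> mirror m"

lemma flip_mirror:
  assumes "flip I i j J"
  shows "reversed.flip (mir J) (m - 1 - j) (m - 1 - i) (mir I)"
proof -
  have less: "i < m" "j < m" "i < j" using flip_less[OF assms] assms by (auto simp: flip_def)
  have ex: "exchange J j i I" using assms unfolding flip_def exchange_def by blast
  have "facet I" "facet J" using assms by (auto simp: flip_def)
  then have "reversed.facet (mir I)" "reversed.facet (mir J)"
    using subword_facet_rev rho_carrier by blast+
  moreover have "exchange (mir J) (m - 1 - j) (m - 1 - i) (mir I)"
    using exchange_mirror[OF facet_subset ex] \<open>facet J\<close> less by blast
  ultimately show ?thesis using less by (auto simp: reversed.flip_iff_exchange)
qed

lemma path_mirror: "path I P J \<Longrightarrow> reversed.path (mir J) (mirror_path m P) (mir I)"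
proof (induction P arbitrary: I)
  case Nil
  then show ?case
    using subword_facet_rev rho_carrier by (auto simp: path_Nil reversed.path_Nil mirror_path_def)
next
  case (Cons e P)
  then obtain i j K where K: "e = (I, K)" "flip I i j K" "path K P J" by (auto simp: path_Cons)
  have "reversed.flip (mir K) (m - 1 - j) (m - 1 - i) (mir I)" using flip_mirror K by blast
  moreover from this have "reversed.facet (mir I)" unfolding reversed.flip_def by blast
  ultimately have "reversed.path (mir K) [(mir K, mir I)] (mir I)"
    unfolding reversed.path_Cons reversed.path_Nil by blast
  then show ?case
    using reversed.path_append[OF Cons.IH[OF K(3)]] K by (simp add: mirror_path_def)
qed

lemma path_edge: "path I P J \<Longrightarrow> e \<in> set P \<Longrightarrow> \<exists>A i j B. e = (A, B) \<and> flip A i j B"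
  by (induction P arbitrary: I) (auto simp: path_Nil path_Cons)

lemma mirror_path_mirror_path:
  assumes "path I P J"
  shows "mirror_path m (mirror_path m P) = P"
proof -
  have "(mir (mir A), mir (mir B)) = (A, B)" if "(A, B) \<in> set P" for A B
    using path_edge[OF assms that] by (auto simp: flip_def mirror_mirror dest!: facet_subset)
  then show ?thesis by (auto simp: mirror_path_def rev_map intro!: map_idI)
qed

lemma p_label_mirror:
  assumes "flip A i j B"
  shows "p_label (mir B, mir A) = m - 1 - n_label (A, B)"
  using reversed.p_label_flip[OF flip_mirror[OF assms]] n_label_flip[OF assms] by simp

lemma n_label_less: "flip A i j B \<Longrightarrow> n_label (A, B) < m"
  using n_label_flip flip_less by metis

lemma labels_mirror_path:
  assumes "path I P J"
  shows "map p_label (mirror_path m P) = rev (map (\<lambda>e. m - 1 - n_label e) P)"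
proof -
  have "map (\<lambda>e. p_label (case e of (A, B) \<Rightarrow> (mir B, mir A))) P = map (\<lambda>e. m - 1 - n_label e) P"
    using path_edge[OF assms] p_label_mirror by (intro map_cong) force+
  then show ?thesis by (simp add: mirror_path_def rev_map comp_def)
qed

text \<open>Two order reversals cancel: the edges are listed backwards and the labels are subtracted
  from \<open>m - 1\<close>. All labels are below \<open>m\<close>, so this subtraction is strictly
  decreasing on them.\<close>

lemma n_rising_mirror:
  assumes "path I P J"
  shows "rising p_label (mirror_path m P) \<longleftrightarrow> rising n_label P"
proof -
  have "\<forall>e\<in>set P. n_label e < m" using path_edge[OF assms] n_label_less by blast
  then have "sorted_wrt (\<lambda>x y. m - 1 - n_label y < m - 1 - n_label x) P \<longleftrightarrow>
      sorted_wrt (\<lambda>x y. n_label x < n_label y) P"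
    by (induction P) force+
  then show ?thesis
    by (simp add: rising_def labels_mirror_path[OF assms] sorted_wrt_rev sorted_wrt_map)
qed

lemma n_falling_mirror:
  assumes "path I P J"
  shows "falling p_label (mirror_path m P) \<longleftrightarrow> falling n_label P"
proof -
  have "\<forall>e\<in>set P. n_label e < m" using path_edge[OF assms] n_label_less by blast
  then have "sorted_wrt (\<lambda>x y. m - 1 - n_label y \<ge> m - 1 - n_label x) P \<longleftrightarrow>
      sorted_wrt (\<lambda>x y. n_label x \<ge> n_label y) P"
    by (induction P) force+
  then show ?thesis
    by (simp add: falling_def labels_mirror_path[OF assms] sorted_wrt_rev sorted_wrt_map)
qed

text \<open>A prefix of the word for \<open>\<rho>\<close> is \<open>\<rho>\<close> times the
  inverse of the remaining suffix, and that inverse is a prefix of the reversed word.\<close>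

lemma T_mirror:
  assumes "facet I" "k \<le> m"
  shows "T I k = act \<rho> \<circ> reversed.T (mir I) (m - k)"
  using assms(2)
proof (induction rule: inc_induct)
  case base
  then show ?case by (simp add: facet_T[OF assms(1)] reversed.T_0)
next
  case (step k)
  have k: "m - k = Suc (m - Suc k)" "m - Suc k < m" "rev Q ! (m - Suc k) = Q ! k"
    using step by (auto simp: rev_nth)
  have mem: "m - Suc k \<in> mir I \<longleftrightarrow> k \<in> I" using step by (auto simp: mirror_def)
  show ?case
  proof (cases "k \<in> I")
    case True
    then show ?thesis using step.IH mem k step.hyps reversed.T_Suc_right[of "m - Suc k" "mir I"]
      by (simp add: T_Suc_right)
  next
    case False
    let ?s = "reflection (\<alpha> (Q ! k))"
    have "?s (?s x) = x" for x
      using reflection_reflection root_nonzero alpha_root Q_nth step.hyps by metis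
    then have "T I k = T I (Suc k) \<circ> ?s"
      using False step.hyps by (simp add: T_Suc_right fun_eq_iff)
    also have "\<dots> = act \<rho> \<circ> (reversed.T (mir I) (m - Suc k) \<circ> ?s)"
      using step.IH by (simp add: fun_eq_iff)
    also have "reversed.T (mir I) (m - Suc k) \<circ> ?s = reversed.T (mir I) (m - k)"
      using False mem k reversed.T_Suc_right[of "m - Suc k" "mir I"] by simp
    finally show ?thesis .
  qed
qed

text \<open>A position in the facet contributes no letter, so the prefixes before and after it
  coincide; for a used letter a sign would appear.\<close>

lemma r_mirror:
  assumes "facet I" "k \<in> I"
  shows "r I k = act \<rho> (reversed.r (mir I) (m - 1 - k))"
proof -
  have k: "k < m" using facet_subset assms by auto
  then have "m - k = Suc (m - 1 - k)" "m - 1 - k < m" "rev Q ! (m - 1 - k) = Q ! k"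
    "m - 1 - k \<in> mir I"
    using assms(2) by (auto simp: rev_nth mirror_def)
  then show ?thesis
    using T_mirror[OF assms(1), of k] k reversed.T_Suc_right[of "m - 1 - k" "mir I"]
    by (simp add: r_eq reversed.r_eq)
qed

lemma facet_mirror_reversed:
  assumes "reversed.facet Z"
  shows "facet (mir Z)"
proof -
  interpret group W by (rule is_group)
  show ?thesis
    using subword_facet_rev[OF assms reversed.rho_carrier] rho_carrier by simp
qed

lemma flippable_mirror_reversed:
  assumes "reversed.facet Z" "flippable W S (rev Q) (inv \<rho>) Z i"
  shows "flippable W S Q \<rho> (mir Z) (m - 1 - i)"
proof -
  obtain j Y where Y: "reversed.facet Y" "exchange Z i j Y"
    using assms unfolding flippable_def by blast
  then have "j < m" using reversed.facet_subset[OF Y(1)] unfolding exchange_def by auto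
  then show ?thesis
    using exchange_mirror[of Z m i j Y] Y reversed.facet_subset[OF assms(1)]
      facet_mirror_reversed[OF Y(1)]
    unfolding flippable_def by auto
qed

text \<open>Flippable positions belong to the facet, so by \<open>r_mirror\<close> the map
  \<open>act \<rho>\<close> carries their roots over and keeps equal roots equal.\<close>

lemma double_root_free_rev:
  assumes "double_root_free W S act \<alpha> Q \<rho>"
  shows "double_root_free W S act \<alpha> (rev Q) (inv \<rho>)"
  unfolding double_root_free_def
proof clarify
  fix Z i j
  assume Z: "reversed.facet Z" and "i \<noteq> j"
    and fl: "flippable W S (rev Q) (inv \<rho>) Z i" "flippable W S (rev Q) (inv \<rho>) Z j"
    and eq: "reversed.r Z i = reversed.r Z j"
  have sub: "Z \<subseteq> {..<m}" using reversed.facet_subset[OF Z] by simp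
  have ij: "i \<in> Z" "j \<in> Z" using fl unfolding flippable_def exchange_def by blast+
  then have less: "i < m" "j < m" using sub by auto
  have f: "facet (mir Z)" by (rule facet_mirror_reversed[OF Z])
  have "r (mir Z) (m - 1 - k) = act \<rho> (reversed.r Z k)" if "k \<in> Z" for k
  proof -
    have "k < m" using that sub by auto
    then have "m - 1 - k \<in> mir Z" "m - 1 - (m - 1 - k) = k" using that by (auto simp: mirror_def)
    then show ?thesis using r_mirror[OF f, of "m - 1 - k"] mirror_mirror[OF sub] by simp
  qed
  then have "r (mir Z) (m - 1 - i) = r (mir Z) (m - 1 - j)" using ij eq by simp
  moreover have "m - 1 - i \<noteq> m - 1 - j" using less \<open>i \<noteq> j\<close> by auto
  ultimately show False
    using assms f flippable_mirror_reversed[OF Z] fl unfolding double_root_free_def by blast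
qed

lemma n_rising_unique:
  assumes "path I P J" "rising n_label P" "path I P' J" "rising n_label P'"
  shows "P = P'"
  using reversed.p_rising_unique[OF path_mirror[OF assms(1)] _ path_mirror[OF assms(3)]] assms
    n_rising_mirror mirror_path_mirror_path by metis

lemma path_mirror_reversed:
  assumes "facet I" "facet J" "reversed.path (mir J) R (mir I)"
  shows "path I (mirror_path m R) J" "mirror_path m (mirror_path m R) = R"
proof -
  interpret group W by (rule is_group)
  have "path (mir (mir I)) (mirror_path m R) (mir (mir J))"
    using subword_complex.path_mirror[OF subword_complex_rev assms(3)] rho_carrier by simp
  then show "path I (mirror_path m R) J"
    using assms mirror_mirror facet_subset by metis
  show "mirror_path m (mirror_path m R) = R"
    using subword_complex.mirror_path_mirror_path[OF subword_complex_rev assms(3)] by simp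
qed

lemma n_rising_exists:
  assumes "double_root_free W S act \<alpha> Q \<rho>" "path I P J"
  shows "\<exists>R. path I R J \<and> rising n_label R \<and> length P \<le> length R"
proof -
  obtain R where R: "reversed.path (mir J) R (mir I)" "rising p_label R" "length P \<le> length R"
    using reversed.p_rising_exists[OF double_root_free_rev path_mirror] assms length_mirror_path
    by metis
  then have "path I (mirror_path m R) J" "mirror_path m (mirror_path m R) = R"
    using path_mirror_reversed path_facet[OF assms(2)] by blast+
  then show ?thesis using R n_rising_mirror length_mirror_path by metis
qed

lemma n_falling_minimal:
  assumes "double_root_free W S act \<alpha> Q \<rho>"
    and "path I P J" "falling n_label P" "path I P' J"
  shows "length P \<le> length P'"
  using reversed.p_falling_minimal[OF double_root_free_rev path_mirror _ path_mirror] assms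
    n_falling_mirror length_mirror_path by metis

end

theorem corollary5p5:
  fixes W :: "('w, 'b) monoid_scheme"
    and S :: "'w set"
    and act :: "'w \<Rightarrow> 'v::euclidean_space \<Rightarrow> 'v"
    and \<Phi> :: "'v set"
    and \<alpha> :: "'w \<Rightarrow> 'v"
    and Q :: "'w list"
    and \<rho> :: 'w
    and I J :: "nat set"
    and l :: "nat set \<times> nat set \<Rightarrow> nat"
  assumes "finite_coxeter_system W S act \<Phi> \<alpha>"
    and "Q \<in> lists S"
    and "\<rho> \<in> carrier W"
    and "double_root_free W S act \<alpha> Q \<rho>"
    and "subword_facet W S Q \<rho> I"
    and "subword_facet W S Q \<rho> J"
    and "\<exists>P. flip_path W S Q \<rho> I P J"
    and "l \<in> {p_label, n_label}"
  shows "(\<exists>!P. flip_path W S Q \<rho> I P J \<and> rising l P) \<and>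
         (\<forall>P. flip_path W S Q \<rho> I P J \<and> rising l P \<longrightarrow>
            (\<forall>P'. flip_path W S Q \<rho> I P' J \<longrightarrow> length P' \<le> length P)) \<and>
         (\<forall>P. flip_path W S Q \<rho> I P J \<and> falling l P \<longrightarrow>
            (\<forall>P'. flip_path W S Q \<rho> I P' J \<longrightarrow> length P \<le> length P'))"
proof -
  interpret subword_complex W S act \<Phi> \<alpha> Q \<rho>
    using assms(1-3)
    by (simp add: subword_complex_def subword_setting_def subword_setting_axioms_def
        subword_complex_axioms_def)
  have unique: "P = P'" if "path I P J" "rising l P" "path I P' J" "rising l P'" for P P'
    using assms(8) p_rising_unique n_rising_unique that by blast
  have longest: "\<exists>R. path I R J \<and> rising l R \<and> length P \<le> length R" if "path I P J" for P
    using assms(8) p_rising_exists[OF assms(4) that] n_rising_exists[OF assms(4) that] by blast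
  have shortest: "length P \<le> length P'" if "path I P J" "falling l P" "path I P' J" for P P'
    using assms(8) p_falling_minimal[OF assms(4)] n_falling_minimal[OF assms(4)] that by blast
  obtain R where R: "path I R J" "rising l R" using assms(7) longest by blast
  have "\<exists>!P. path I P J \<and> rising l P" using R unique by blast
  moreover have "length P' \<le> length P" if "path I P J" "rising l P" "path I P' J" for P P'
    using longest[OF that(3)] unique[OF that(1,2)] by blast
  ultimately show ?thesis using shortest by blast
qed

end
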